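(* Let $\mathcal{L}:\mathcal{M}_d\to\mathcal{M}_d$ be a doubly stochastic and primitive Liouvillian with spectral gap $\lambda$, and let $\|\frac{\mathcal{L}+\mathcal{L}^*}{2}\|$ be the operator norm of its additive symmetrization. Then for any $n\in\mathbb{N}$, $$\Big\|\frac{\mathcal{L}+\mathcal{L}^*}{2}\Big\|\,\alpha_2(\mathcal{L}_{\text{dep}}^{(n)})\geq\alpha_2(\mathcal{L}^{(n)})\geq\lambda\,\alpha_2(\mathcal{L}_{\text{dep}}^{(n)}).$$
   Context: $\mathcal{M}_D$: complex $D\times D$ matrices; $\mathcal{M}_D^+$: positive definite ones. A Liouvillian is the generator $\mathcal{L}$ of a quantum dynamical semigroup $T_t=e^{t\mathcal{L}}$ (continuous semigroup of completely positive trace-preserving maps, $T_0=\text{id}$). $\mathcal{L}^*$ is the adjoint w.r.t. the Hilbert–Schmidt inner product $\langle X,Y\rangle=\text{tr}(X^\dagger Y)$; the operator norm is w.r.t. this inner product. $\mathcal{L}$ is doubly stochastic if $\mathcal{L}(\mathbb{1}_d)=0$ (i.e. $\mathbb{1}_d/d$ is a fixed point) and primitive if $\lim_{t\to\infty}T_t(\rho)=\mathbb{1}_d/d$ for all density matrices $\rho$. The depolarizing Liouvillian is $\mathcal{L}_{\text{dep}}(X)=\text{tr}(X)\frac{\mathbb{1}_d}{d}-X$. For a Liouvillian $\mathcal{L}$ on $\mathcal{M}_d$, $\mathcal{L}^{(n)}=\sum_{i=1}^n\text{id}_d^{\otimes(i-1)}\otimes\mathcal{L}\otimes\text{id}_d^{\otimes(n-i)}$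 on $\mathcal{M}_{d^n}$. For a doubly stochastic Liouvillian on $\mathcal{M}_D$: Dirichlet form $\mathcal{E}^2_{\mathcal{L}}(X)=-\frac1D\text{tr}[\mathcal{L}(X)X]$; $\text{Ent}_2(X)=\frac{1}{2D}\text{tr}[X^2(\log\frac{X^2}{\text{tr}(X^2)}+\log D)]$; LS-2 constant $\alpha_2(\mathcal{L})=\inf_{X\in\mathcal{M}_D^+}\mathcal{E}^2_{\mathcal{L}}(X)/\text{Ent}_2(X)$; spectral gap $\lambda(\mathcal{L})=\inf\mathcal{E}^2_{\mathcal{L}}(X)/\text{Var}(X)$ over Hermitian $X$ not proportional to $\mathbb{1}$, with $\text{Var}(X)=\frac1D\text{tr}[(X-\text{tr}(X)\frac{\mathbb{1}}{D})^2]$. *)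

theory Defs
  imports "HOL-Analysis.Analysis"
begin

text \<open>Complex matrices indexed by a finite index set I (entries outside I are zero),
  represented as functions. Superoperators are maps on such matrices.\<close>

type_synonym 'i cmat = "'i \<Rightarrow> 'i \<Rightarrow> complex"
type_synonym 'i sop = "'i cmat \<Rightarrow> 'i cmat"

definition mats :: "'i set \<Rightarrow> 'i cmat set" where
  "mats I = {A. \<forall>i j. i \<notin> I \<or> j \<notin> I \<longrightarrow> A i j = 0}"

definition mzero :: "'i cmat" where "mzero = (\<lambda>i j. 0)"

definition madd :: "'i cmat \<Rightarrow> 'i cmat \<Rightarrow> 'i cmat" where
  "madd A B = (\<lambda>i j. A i j + B i j)"

definition mscale :: "complex \<Rightarrow> 'i cmat \<Rightarrow> 'i cmat" where
  "mscale c A = (\<lambda>i j. c * A i j)"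

definition mmult :: "'i set \<Rightarrow> 'i cmat \<Rightarrow> 'i cmat \<Rightarrow> 'i cmat" where
  "mmult I A B = (\<lambda>i j. \<Sum>k\<in>I. A i k * B k j)"

definition mone :: "'i set \<Rightarrow> 'i cmat" where
  "mone I = (\<lambda>i j. if i = j \<and> i \<in> I then 1 else 0)"

definition munit :: "'i \<Rightarrow> 'i \<Rightarrow> 'i cmat" where
  "munit r s = (\<lambda>i j. if i = r \<and> j = s then 1 else 0)"

definition mtrace :: "'i set \<Rightarrow> 'i cmat \<Rightarrow> complex" where
  "mtrace I A = (\<Sum>i\<in>I. A i i)"

definition madj :: "'i cmat \<Rightarrow> 'i cmat" where
  "madj A = (\<lambda>i j. cnj (A j i))"

definition hermitian :: "'i set \<Rightarrow> 'i cmat \<Rightarrow> bool" where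
  "hermitian I A \<longleftrightarrow> A \<in> mats I \<and> madj A = A"

definition qform :: "'i set \<Rightarrow> 'i cmat \<Rightarrow> ('i \<Rightarrow> complex) \<Rightarrow> complex" where
  "qform I A v = (\<Sum>i\<in>I. \<Sum>j\<in>I. cnj (v i) * A i j * v j)"

definition psd :: "'i set \<Rightarrow> 'i cmat \<Rightarrow> bool" where
  "psd I A \<longleftrightarrow> hermitian I A \<and> (\<forall>v. Re (qform I A v) \<ge> 0)"

definition posdef :: "'i set \<Rightarrow> 'i cmat \<Rightarrow> bool" where
  "posdef I A \<longleftrightarrow> hermitian I A \<and> (\<forall>v. (\<exists>i\<in>I. v i \<noteq> 0) \<longrightarrow> Re (qform I A v) > 0)"

definition density :: "'i set \<Rightarrow> 'i cmat \<Rightarrow> bool" where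
  "density I \<rho> \<longleftrightarrow> psd I \<rho> \<and> mtrace I \<rho> = 1"

definition mpow :: "'i set \<Rightarrow> 'i cmat \<Rightarrow> nat \<Rightarrow> 'i cmat" where
  "mpow I A k = ((mmult I A) ^^ k) (mone I)"

definition mexp :: "'i set \<Rightarrow> 'i cmat \<Rightarrow> 'i cmat" where
  "mexp I A = (\<lambda>i j. \<Sum>k. mpow I A k i j / of_nat (fact k))"

definition mlog :: "'i set \<Rightarrow> 'i cmat \<Rightarrow> 'i cmat" where
  "mlog I A = (THE B. hermitian I B \<and> mexp I B = A)"

definition sop_on :: "'i set \<Rightarrow> 'i sop \<Rightarrow> bool" where
  "sop_on I L \<longleftrightarrow> (\<forall>X\<in>mats I. L X \<in> mats I) \<and>
     (\<forall>X\<in>mats I. \<forall>Y\<in>mats I. \<forall>a b. L (madd (mscale a X) (mscale b Y)) = madd (mscale a (L X)) (mscale b (L Y)))"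

definition sop_exp :: "'i set \<Rightarrow> real \<Rightarrow> 'i sop \<Rightarrow> 'i sop" where
  "sop_exp I t L X = (\<lambda>i j. \<Sum>k. complex_of_real (t ^ k / fact k) * (L ^^ k) X i j)"

text \<open>id_k tensor T acting on matrices indexed by {0..<k} x I\<close>
definition ampl :: "nat \<Rightarrow> 'i sop \<Rightarrow> (nat \<times> 'i) cmat \<Rightarrow> (nat \<times> 'i) cmat" where
  "ampl k T Y = (\<lambda>p q. if fst p < k \<and> fst q < k
       then T (\<lambda>i j. Y (fst p, i) (fst q, j)) (snd p) (snd q) else 0)"

definition completely_positive :: "'i set \<Rightarrow> 'i sop \<Rightarrow> bool" where
  "completely_positive I T \<longleftrightarrow>
     (\<forall>k::nat. \<forall>Y. psd ({0..<k} \<times> I) Y \<longrightarrow> psd ({0..<k} \<times> I) (ampl k T Y))"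

definition trace_preserving :: "'i set \<Rightarrow> 'i sop \<Rightarrow> bool" where
  "trace_preserving I T \<longleftrightarrow> (\<forall>X\<in>mats I. mtrace I (T X) = mtrace I X)"

definition liouvillian :: "'i set \<Rightarrow> 'i sop \<Rightarrow> bool" where
  "liouvillian I L \<longleftrightarrow> sop_on I L \<and>
     (\<forall>t\<ge>0. completely_positive I (sop_exp I t L) \<and> trace_preserving I (sop_exp I t L))"

definition doubly_stochastic :: "'i set \<Rightarrow> 'i sop \<Rightarrow> bool" where
  "doubly_stochastic I L \<longleftrightarrow> L (mone I) = mzero"

definition primitive :: "'i set \<Rightarrow> 'i sop \<Rightarrow> bool" where
  "primitive I L \<longleftrightarrow> (\<forall>\<rho>. density I \<rho> \<longrightarrow>
     (\<forall>i j. ((\<lambda>t. sop_exp I t L \<rho> i j) \<longlongrightarrow> mone I i j / of_nat (card I)) at_top))"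

definition ldep :: "'i set \<Rightarrow> 'i sop" where
  "ldep I X = (\<lambda>i j. mtrace I X * mone I i j / of_nat (card I) - X i j)"

definition sop_adj :: "'i set \<Rightarrow> 'i sop \<Rightarrow> 'i sop" where
  "sop_adj I L Y = (\<lambda>p q. if p \<in> I \<and> q \<in> I then
      (\<Sum>r\<in>I. \<Sum>s\<in>I. cnj (L (munit p q) r s) * Y r s) else 0)"

definition sop_sym :: "'i set \<Rightarrow> 'i sop \<Rightarrow> 'i sop" where
  "sop_sym I L X = (\<lambda>i j. (L X i j + sop_adj I L X i j) / 2)"

definition hs_norm :: "'i set \<Rightarrow> 'i cmat \<Rightarrow> real" where
  "hs_norm I X = sqrt (\<Sum>i\<in>I. \<Sum>j\<in>I. (cmod (X i j))\<^sup>2)"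

definition op_norm :: "'i set \<Rightarrow> 'i sop \<Rightarrow> real" where
  "op_norm I S = Sup {hs_norm I (S X) | X. X \<in> mats I \<and> hs_norm I X = 1}"

text \<open>n-fold tensor product space (C^d)^{\<otimes>n}: indices are tuples a : {..<n} \<rightarrow> {..<d}\<close>
definition tens :: "nat \<Rightarrow> nat \<Rightarrow> (nat \<Rightarrow> nat) set" where
  "tens d n = PiE {..<n} (\<lambda>_. {..<d})"

text \<open>id^{\<otimes>k} \<otimes> L \<otimes> id^{\<otimes>(n-k-1)} (L acting on tensor factor k)\<close>
definition site_op :: "nat \<Rightarrow> nat \<Rightarrow> nat sop \<Rightarrow> nat \<Rightarrow> (nat \<Rightarrow> nat) sop" where
  "site_op d n L k X = (\<lambda>a b. if a \<in> tens d n \<and> b \<in> tens d n then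
      (\<Sum>r<d. \<Sum>s<d. L (munit r s) (a k) (b k) * X (a(k := r)) (b(k := s))) else 0)"

definition lift :: "nat \<Rightarrow> nat \<Rightarrow> nat sop \<Rightarrow> (nat \<Rightarrow> nat) sop" where
  "lift d n L X = (\<lambda>a b. \<Sum>k<n. site_op d n L k X a b)"

definition dirichlet :: "'i set \<Rightarrow> 'i sop \<Rightarrow> 'i cmat \<Rightarrow> real" where
  "dirichlet I L X = - Re (mtrace I (mmult I (L X) X)) / real (card I)"

definition ent2 :: "'i set \<Rightarrow> 'i cmat \<Rightarrow> real" where
  "ent2 I X = (let X2 = mmult I X X in
     Re (mtrace I (mmult I X2 (madd (mlog I (mscale (1 / mtrace I X2) X2))
                                    (mscale (of_real (ln (real (card I)))) (mone I)))))
     / (2 * real (card I)))"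

definition alpha2 :: "'i set \<Rightarrow> 'i sop \<Rightarrow> real" where
  "alpha2 I L = Inf {dirichlet I L X / ent2 I X | X. posdef I X \<and> \<not> (\<exists>c. X = mscale c (mone I))}"

definition variance :: "'i set \<Rightarrow> 'i cmat \<Rightarrow> real" where
  "variance I X = (let Y = madd X (mscale (- mtrace I X / of_nat (card I)) (mone I)) in
     Re (mtrace I (mmult I Y Y)) / real (card I))"

definition spectral_gap :: "'i set \<Rightarrow> 'i sop \<Rightarrow> real" where
  "spectral_gap I L = Inf {dirichlet I L X / variance I X | X. hermitian I X \<and> \<not> (\<exists>c. X = mscale c (mone I))}"

end

theory Submission
  imports Defs "HOL-Computational_Algebra.Fundamental_Theorem_Algebra"
begin

text \<open>
  Both Dirichlet forms of a lifted Liouvillian are sums over sites \<open>k\<close> and over the remaining tensor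
  indices of \<open>- Re \<langle>Y, L Y\<rangle>\<close>, where \<open>Y\<close> runs through the \<open>d \<times> d\<close> slices of \<open>X\<close> at site \<open>k\<close>. So
  it suffices to compare the quadratic forms of \<open>L\<close> and of the depolarizing Liouvillian on a single
  site. There \<open>- Re \<langle>Y, L\<^sub>d\<^sub>e\<^sub>p Y\<rangle> = \<parallel>Y - tr Y / d\<parallel>\<^sup>2\<close>; the upper bound is Cauchy--Schwarz for the
  symmetrization on the centred matrix, and the lower bound is the definition of the gap, extended
  from Hermitian to arbitrary \<open>Y\<close> because \<open>L\<close> preserves Hermiticity. Nonnegativity of the gap
  follows from the Kadison--Schwarz inequality for the semigroup, differentiated at time 0. Finally
  the inequalities are divided by \<open>ent2 X\<close>, which is nonnegative; only there the logarithm, and with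
  it the spectral theorem, is needed.
\<close>

subsection \<open>Spectral theorem and entropy\<close>

text \<open>\<open>liouvillian\<close> provides no Lindblad form, only complete positivity and trace
  preservation of \<open>sop_exp\<close> for times t \<ge> 0. Properties of \<open>L\<close> itself
  are therefore limits of difference quotients taken from the right at 0.

  \<open>mlog\<close> is a definite description, so \<open>ent2\<close> has a usable value only once
  the Hermitian logarithm is known to exist and to be unique. Uniqueness is why diagonalisations in
  two unrelated bases have to be compared.

  The gap is an infimum over Hermitian matrices, but the slice of a Hermitian matrix at different
  row and column tuples is in general not Hermitian; this forces the extension to arbitrary
  \<open>Y\<close>. Slices are indexed by full tuples, so each one occurs d^2 times, which accounts
  for the extra divisor in the Dirichlet form.

  Where \<open>ent2 X\<close> vanishes, both quotients are 0 by the convention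
  \<open>x / 0 = 0\<close>, so dividing by a nonnegative number keeps the comparison. The infima are
  taken over sets of reals; using them requires nonemptiness in one direction and the lower bound 0
  in the other.\<close>

text \<open>Gaussian elimination, one equation at a time. It supplies the dimension counts below: a
  Krylov dependence, a vector orthogonal to a partial basis, and the maximality of an orthonormal
  family.\<close>

lemma homogeneous_system_nontrivial:
  fixes a :: "'j \<Rightarrow> 'k \<Rightarrow> 'f::field"
  assumes "finite J" "finite K" "card J < card K"
  shows "\<exists>x. (\<exists>k\<in>K. x k \<noteq> 0) \<and> (\<forall>j\<in>J. (\<Sum>k\<in>K. a j k * x k) = 0)"
  using assms
proof (induction J arbitrary: K a rule: finite_induct)
  case empty
  then have "K \<noteq> {}" by auto
  then show ?case by (intro exI[of _ "\<lambda>_. 1"]) auto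
next
  case (insert j J)
  show ?case
  proof (cases "\<forall>k\<in>K. a j k = 0")
    case True
    have "card J < card K" using insert by simp
    from insert.IH[OF insert.prems(1) this, of a]
    obtain x where "\<exists>k\<in>K. x k \<noteq> 0" "\<forall>j\<in>J. (\<Sum>k\<in>K. a j k * x k) = 0" by blast
    then show ?thesis using True by (intro exI[of _ x]) auto
  next
    case False
    then obtain l where l: "l \<in> K" "a j l \<noteq> 0" by auto
    define K' where "K' = K - {l}"
    have K: "K = insert l K'" "l \<notin> K'" "finite K'"
      using l insert.prems by (auto simp: K'_def)
    have card: "card J < card K'"
      using insert.prems insert.hyps K by simp
    \<comment> \<open>The remaining rows after eliminating unknown \<open>l\<close> with the pivot
      \<open>a j l\<close>.\<close>
    define a' where "a' = (\<lambda>i k. a i k - a i l * a j k / a j l)"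
    obtain x where x: "\<exists>k\<in>K'. x k \<noteq> 0" "\<forall>i\<in>J. (\<Sum>k\<in>K'. a' i k * x k) = 0"
      using insert.IH[OF K(3) card, of a'] by blast
    \<comment> \<open>The value at \<open>l\<close> is chosen to solve equation \<open>j\<close>;
      the other equations then reduce to those of \<open>a'\<close>.\<close>
    define y where "y = x(l := - (\<Sum>k\<in>K'. a j k * x k) / a j l)"
    have yx: "(\<Sum>k\<in>K'. c k * y k) = (\<Sum>k\<in>K'. c k * x k)" for c
      by (rule sum.cong) (use K in \<open>auto simp: y_def\<close>)
    have S: "(\<Sum>k\<in>K. c k * y k) = (\<Sum>k\<in>K'. c k * x k) - c l * (\<Sum>k\<in>K'. a j k * x k) / a j l" for c
      using K by (simp add: yx) (simp add: y_def)
    have "(\<Sum>k\<in>K. a i k * y k) = 0" if "i \<in> J" for i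
    proof -
      have "(\<Sum>k\<in>K'. a' i k * x k) = (\<Sum>k\<in>K'. a i k * x k) - a i l * (\<Sum>k\<in>K'. a j k * x k) / a j l"
        unfolding a'_def
        by (simp add: algebra_simps sum_subtractf sum_distrib_left sum_divide_distrib)
      then show ?thesis using x(2) that S[of "a i"] by simp
    qed
    moreover have "(\<Sum>k\<in>K. a j k * y k) = 0" using S[of "a j"] l by simp
    moreover have "\<exists>k\<in>K. y k \<noteq> 0"
      using x(1) K by (auto simp: y_def intro!: bexI split: if_splits)
    ultimately show ?thesis by auto
  qed
qed

text \<open>Take p of least degree with p(A) v = 0 and a root z of it. Writing p = (x - z) q, the
  vector q(A) v is nonzero and is killed by A - z. The set \<open>W\<close> keeps the eigenvector
  inside a prescribed invariant subspace, later the orthogonal complement of the eigenvectors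
  already found.\<close>

lemma krylov_eigenvector:
  fixes A :: "'i \<Rightarrow> 'i \<Rightarrow> complex" and v :: "'i \<Rightarrow> complex"
  assumes fin: "finite I" and v: "\<exists>i\<in>I. v i \<noteq> 0"
    and W: "v \<in> W"
    and invW: "\<And>w. w \<in> W \<Longrightarrow> (\<lambda>i. \<Sum>j\<in>I. A i j * w j) \<in> W"
    and linW: "\<And>w w' c. w \<in> W \<Longrightarrow> w' \<in> W \<Longrightarrow> (\<lambda>i. w i + c * w' i) \<in> W"
    and zeroW: "(\<lambda>i. 0) \<in> W"
  shows "\<exists>z w. w \<in> W \<and> (\<exists>i\<in>I. w i \<noteq> 0) \<and> (\<forall>i\<in>I. (\<Sum>j\<in>I. A i j * w j) = z * w i)"
proof -
  define N where "N = card I"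
  define E where "E = (\<lambda>k. ((\<lambda>w i. \<Sum>j\<in>I. A i j * w j) ^^ k) v)"
  have E0: "E 0 = v" and ES: "E (Suc k) = (\<lambda>i. \<Sum>j\<in>I. A i j * E k j)" for k
    by (simp_all add: E_def)
  have EW: "E k \<in> W" for k
    by (induction k) (auto simp: E0 ES W intro: invW)
  \<comment> \<open>\<open>P p\<close> is the vector p(A) v.\<close>
  define P where "P = (\<lambda>p i. \<Sum>k\<le>degree p. coeff p k * E k i)"
  \<comment> \<open>Padding with zero coefficients lets polynomials of different degrees share one
    summation range.\<close>
  have P_bound: "P p i = (\<Sum>k\<le>m. coeff p k * E k i)" if "degree p \<le> m" for p m i
    unfolding P_def by (rule sum.mono_neutral_left) (use that in \<open>auto simp: coeff_eq_0\<close>)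
  have PW: "P p \<in> W" for p
  proof -
    have "(\<lambda>i. \<Sum>k<m. coeff p k * E k i) \<in> W" for m
      by (induction m) (auto simp: zeroW EW intro: linW)
    then have "(\<lambda>i. \<Sum>k<Suc (degree p). coeff p k * E k i) \<in> W" .
    then show ?thesis unfolding P_def lessThan_Suc_atMost .
  qed
  have P_shift: "P (pCons 0 q) i = (\<Sum>j\<in>I. A i j * P q j)" for q i
  proof -
    have "P (pCons 0 q) i = (\<Sum>k\<le>Suc (degree q). coeff (pCons 0 q) k * E k i)"
      by (rule P_bound) (rule degree_pCons_le)
    also have "\<dots> = (\<Sum>k\<le>degree q. coeff q k * E (Suc k) i)"
      by (subst sum.atMost_Suc_shift) simp
    also have "\<dots> = (\<Sum>k\<le>degree q. \<Sum>j\<in>I. A i j * (coeff q k * E k j))"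
      by (simp add: ES sum_distrib_left algebra_simps)
    also have "\<dots> = (\<Sum>j\<in>I. A i j * P q j)"
      by (subst sum.swap) (simp add: P_def sum_distrib_left)
    finally show ?thesis .
  qed
  have P_lin: "P ([:-z, 1:] * q) i = (\<Sum>j\<in>I. A i j * P q j) - z * P q i" for z q i
  proof -
    have eq: "[:-z, 1:] * q = pCons 0 q - smult z q" by simp
    define m where "m = Suc (degree q)"
    have d: "degree (pCons 0 q) \<le> m" "degree (smult z q) \<le> m" "degree q \<le> m"
      by (auto simp: m_def degree_pCons_le intro: order.trans[OF degree_smult_le])
    have "P ([:-z, 1:] * q) i = P (pCons 0 q) i - z * P q i"
      unfolding eq P_bound[OF degree_diff_le[OF d(1,2)]] P_bound[OF d(1)] P_bound[OF d(3)]
      by (simp add: algebra_simps sum_subtractf sum_distrib_left)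
    then show ?thesis by (simp add: P_shift)
  qed
  define ann where "ann = (\<lambda>p. p \<noteq> 0 \<and> (\<forall>i\<in>I. P p i = 0))"
  \<comment> \<open>A relation among v, A v, ..., A^N v: \<open>card I\<close> equations in
    \<open>N + 1\<close> unknowns.\<close>
  obtain c where c: "\<exists>k\<in>{..N}. c k \<noteq> 0" "\<forall>i\<in>I. (\<Sum>k\<in>{..N}. E k i * c k) = 0"
    using homogeneous_system_nontrivial[OF fin, of "{..N}" "\<lambda>i k. E k i"]
    by (auto simp: N_def)
  define p0 where "p0 = (\<Sum>k\<le>N. monom (c k) k)"
  have cp0: "coeff p0 k = (if k \<le> N then c k else 0)" for k
    by (simp add: p0_def coeff_sum)
  have dp0: "degree p0 \<le> N"
    by (rule degree_le) (simp add: cp0)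
  have "ann p0"
    unfolding ann_def
  proof
    show "p0 \<noteq> 0" using c(1) cp0 by (metis atMost_iff coeff_0)
    show "\<forall>i\<in>I. P p0 i = 0"
      using c(2) by (simp add: P_bound[OF dp0] cp0 mult.commute)
  qed
  then obtain p where p: "ann p" and pmin: "\<And>q. ann q \<Longrightarrow> degree p \<le> degree q"
    using arg_min_nat_lemma[of ann p0 degree] by blast
  \<comment> \<open>A nonzero constant annihilating \<open>v\<close> would force \<open>v\<close> to
    vanish on \<open>I\<close>; hence \<open>p\<close> has a root.\<close>
  have "degree p \<noteq> 0"
  proof
    assume "degree p = 0"
    then obtain a where a: "p = [:a:]" by (rule degree_eq_zeroE)
    then have "a \<noteq> 0" using p by (auto simp: ann_def)
    moreover have "a * v i = 0" if "i \<in> I" for i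
      using p a that by (auto simp: ann_def P_def E0)
    ultimately show False using v by auto
  qed
  then obtain z where "poly p z = 0"
    using fundamental_theorem_of_algebra[of p] by (auto simp: constant_degree)
  then obtain q where q: "p = [:-z, 1:] * q"
    by (auto simp: poly_eq_0_iff_dvd)
  have q0: "q \<noteq> 0" using p q by (auto simp: ann_def)
  have "degree p = Suc (degree q)"
    unfolding q by (subst degree_mult_eq) (use q0 in auto)
  then have "\<not> ann q" using pmin[of q] by auto
  then have "\<exists>i\<in>I. P q i \<noteq> 0" using q0 by (auto simp: ann_def)
  moreover have "(\<Sum>j\<in>I. A i j * P q j) = z * P q i" if "i \<in> I" for i
    using p P_lin[of z q i] that unfolding ann_def q by auto
  ultimately show ?thesis using PW by blast
qed

section \<open>Orthonormal families and the eigenbasis of a Hermitian matrix\<close>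

definition orthonormal :: "'i set \<Rightarrow> 'k set \<Rightarrow> ('k \<Rightarrow> 'i \<Rightarrow> complex) \<Rightarrow> bool" where
  "orthonormal I J u \<longleftrightarrow>
     (\<forall>m\<in>J. \<forall>l\<in>J. (\<Sum>i\<in>I. cnj (u m i) * u l i) = (if m = l then 1 else 0))"

lemma hermitian_sym: "hermitian I A \<Longrightarrow> cnj (A i j) = A j i"
  unfolding hermitian_def madj_def by metis

lemma hermitian_inner_move:
  assumes "hermitian I A"
  shows "(\<Sum>i\<in>I. cnj (x i) * (\<Sum>j\<in>I. A i j * y j)) = (\<Sum>i\<in>I. cnj (\<Sum>j\<in>I. A i j * x j) * y i)"
  by (simp add: sum_distrib_left sum_distrib_right hermitian_sym[OF assms], subst sum.swap)
     (simp add: algebra_simps)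

lemma cnj_mult_self_sum: "(\<Sum>i\<in>I. cnj (w i) * w i) = of_real (\<Sum>i\<in>I. (cmod (w i))\<^sup>2)"
  by (simp add: complex_norm_square[symmetric] mult.commute del: of_real_power)

text \<open>Otherwise \<open>x\<close> and the \<open>u m\<close> would be \<open>card I + 1\<close>
  nonzero, mutually orthogonal vectors with \<open>card I\<close> coordinates. They satisfy a linear
  relation, and pairing it with each vector kills the coefficient of that vector.\<close>

lemma orthonormal_complement_trivial:
  assumes fin: "finite I" and o: "orthonormal I I u"
    and x: "\<And>m. m \<in> I \<Longrightarrow> (\<Sum>i\<in>I. cnj (u m i) * x i) = 0" and j: "j \<in> I"
  shows "x j = 0"
proof (rule ccontr)
  assume xj: "x j \<noteq> 0"
  \<comment> \<open>\<open>None\<close> is a fresh index for the extra vector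
    \<open>x\<close>.\<close>
  define U where "U = (\<lambda>m. case m of None \<Rightarrow> x | Some m \<Rightarrow> u m)"
  define K where "K = insert None (Some ` I)"
  have K: "finite K" "card I < card K"
    using fin by (auto simp: K_def card_image)
  obtain c where c: "\<exists>k\<in>K. c k \<noteq> 0" "\<forall>i\<in>I. (\<Sum>k\<in>K. U k i * c k) = 0"
    using homogeneous_system_nontrivial[OF fin K, of "\<lambda>i k. U k i"] by blast
  have orth: "(\<Sum>i\<in>I. cnj (U k i) * U l i) = 0" if "k \<in> K" "l \<in> K" "k \<noteq> l" for k l
  proof -
    have "(\<Sum>i\<in>I. cnj (x i) * u m i) = cnj (\<Sum>i\<in>I. cnj (u m i) * x i)" for m
      by (simp add: mult.commute)
    then have x': "(\<Sum>i\<in>I. cnj (x i) * u m i) = 0" if "m \<in> I" for m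
      using x[OF that] by (simp del: cnj_sum)
    have "(\<Sum>i\<in>I. cnj (u m i) * u l i) = 0" if "m \<in> I" "l \<in> I" "m \<noteq> l" for m l
      using o that by (simp add: orthonormal_def)
    then show ?thesis using that x x'
      by (cases k; cases l) (auto simp: K_def U_def)
  qed
  have "c k = 0" if k: "k \<in> K" for k
  proof -
    have "0 = (\<Sum>i\<in>I. cnj (U k i) * (\<Sum>l\<in>K. U l i * c l))" using c by simp
    also have "\<dots> = (\<Sum>l\<in>K. c l * (\<Sum>i\<in>I. cnj (U k i) * U l i))"
      by (simp add: sum_distrib_left, subst sum.swap) (simp add: algebra_simps)
    also have "\<dots> = (\<Sum>l\<in>K. if l = k then c k * (\<Sum>i\<in>I. cnj (U k i) * U k i) else 0)"
      by (rule sum.cong) (use k orth in auto)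
    also have "\<dots> = c k * (\<Sum>i\<in>I. cnj (U k i) * U k i)"
      using k K by simp
    finally have *: "c k * (\<Sum>i\<in>I. cnj (U k i) * U k i) = 0" by simp
    have "(\<Sum>i\<in>I. cnj (U k i) * U k i) \<noteq> 0"
    proof (cases k)
      case None
      have "(\<Sum>i\<in>I. (cmod (x i))\<^sup>2) \<noteq> 0"
        using xj j fin by (subst sum_nonneg_eq_0_iff) auto
      then show ?thesis using None by (simp add: U_def cnj_mult_self_sum del: of_real_sum)
    next
      case (Some m)
      then show ?thesis using k o by (auto simp: K_def U_def orthonormal_def)
    qed
    then show ?thesis using * by simp
  qed
  then show False using c(1) by blast
qed

text \<open>What remains of the \<open>j\<close>-th standard basis vector after projection onto the
  \<open>u m\<close> is orthogonal to all of them, hence zero.\<close>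

lemma orthonormal_completeness:
  assumes fin: "finite I" and o: "orthonormal I I u" and i: "i \<in> I" and j: "j \<in> I"
  shows "(\<Sum>m\<in>I. u m i * cnj (u m j)) = (if i = j then 1 else 0)"
proof -
  define x where "x = (\<lambda>i. (if i = j then 1 else 0) - (\<Sum>m\<in>I. u m i * cnj (u m j)))"
  have "(\<Sum>i\<in>I. cnj (u l i) * x i) = 0" if l: "l \<in> I" for l
  proof -
    have "(\<Sum>i\<in>I. cnj (u l i) * x i)
        = (\<Sum>i\<in>I. cnj (u l i) * (if i = j then 1 else 0))
          - (\<Sum>i\<in>I. \<Sum>m\<in>I. cnj (u l i) * u m i * cnj (u m j))"
      by (simp add: x_def algebra_simps sum_subtractf sum_distrib_left)
    also have "(\<Sum>i\<in>I. cnj (u l i) * (if i = j then 1 else 0)) = cnj (u l j)"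
      using fin j by (simp add: if_distrib[of "\<lambda>x. _ * x"] cong: if_cong)
    also have "(\<Sum>i\<in>I. \<Sum>m\<in>I. cnj (u l i) * u m i * cnj (u m j))
        = (\<Sum>m\<in>I. (\<Sum>i\<in>I. cnj (u l i) * u m i) * cnj (u m j))"
      by (subst sum.swap) (simp add: sum_distrib_right)
    also have "\<dots> = (\<Sum>m\<in>I. if m = l then cnj (u l j) else 0)"
      by (rule sum.cong) (use o l in \<open>auto simp: orthonormal_def\<close>)
    also have "\<dots> = cnj (u l j)" using l fin by simp
    finally show ?thesis by simp
  qed
  from orthonormal_complement_trivial[OF fin o this i] show ?thesis by (simp add: x_def)
qed

text \<open>For orthonormal \<open>u\<close>, the matrix with eigenvectors \<open>u m\<close> and
  real eigenvalues \<open>f m\<close>. Products, sums, exponential and logarithm then act on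
  \<open>f\<close> pointwise.\<close>

definition spectral_sum :: "'i set \<Rightarrow> ('i \<Rightarrow> 'i \<Rightarrow> complex) \<Rightarrow> ('i \<Rightarrow> real) \<Rightarrow> 'i cmat" where
  "spectral_sum I u f = (\<lambda>i j. if i \<in> I \<and> j \<in> I then \<Sum>m\<in>I. of_real (f m) * u m i * cnj (u m j) else 0)"

text \<open>The vectors orthogonal to the eigenvectors found so far form a nonzero subspace by
  counting, and an invariant one because \<open>A\<close> is Hermitian, so the Krylov argument
  yields the next eigenvector inside it. The index set \<open>J \<subseteq> I\<close> is what the
  induction enlarges.\<close>

lemma hermitian_eigenbasis:
  fixes A :: "'i cmat"
  assumes fin: "finite I" and A: "hermitian I A"
  shows "\<exists>u b. orthonormal I I u \<and>
     (\<forall>m\<in>I. \<forall>i\<in>I. (\<Sum>j\<in>I. A i j * u m j) = of_real (b m) * u m i)"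
proof -
  have "\<exists>u b. orthonormal I J u \<and>
     (\<forall>m\<in>J. \<forall>i\<in>I. (\<Sum>j\<in>I. A i j * u m j) = of_real (b m) * u m i)" if "J \<subseteq> I" for J :: "'i set"
  proof -
    have "finite J" using that fin finite_subset by auto
    then show ?thesis using that
    proof (induction J rule: finite_induct)
      case empty
      then show ?case by (auto simp: orthonormal_def)
    next
      case (insert m J)
      have "J \<subseteq> I" using insert.prems by simp
      from insert.IH[OF this] obtain u and b :: "'i \<Rightarrow> real" where o: "orthonormal I J u"
        and e0: "\<forall>m\<in>J. \<forall>i\<in>I. (\<Sum>j\<in>I. A i j * u m j) = of_real (b m) * u m i"
        by blast
      have e: "(\<Sum>j\<in>I. A i j * u l j) = of_real (b l) * u l i" if "l \<in> J" "i \<in> I" for l i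
        using e0 that by blast
      have "card J < card I"
        using insert.hyps insert.prems fin by (intro psubset_card_mono) auto
      from homogeneous_system_nontrivial[OF insert.hyps(1) fin this, of "\<lambda>l i. cnj (u l i)"]
      obtain v where v: "\<exists>i\<in>I. v i \<noteq> 0" "\<forall>l\<in>J. (\<Sum>i\<in>I. cnj (u l i) * v i) = 0" by blast
      define W where "W = {w. \<forall>l\<in>J. (\<Sum>i\<in>I. cnj (u l i) * w i) = 0}"
      have "\<exists>z w. w \<in> W \<and> (\<exists>i\<in>I. w i \<noteq> 0) \<and> (\<forall>i\<in>I. (\<Sum>j\<in>I. A i j * w j) = z * w i)"
      proof (rule krylov_eigenvector[OF fin v(1)])
        show "v \<in> W" using v by (auto simp: W_def)
        show "(\<lambda>i. 0) \<in> W" by (auto simp: W_def)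
        show "(\<lambda>i. w i + c * w' i) \<in> W" if "w \<in> W" "w' \<in> W" for w w' c
        proof -
          have "(\<Sum>i\<in>I. cnj (u l i) * (w i + c * w' i))
            = (\<Sum>i\<in>I. cnj (u l i) * w i) + c * (\<Sum>i\<in>I. cnj (u l i) * w' i)" for l
            by (simp add: algebra_simps sum.distrib sum_distrib_left)
          then show ?thesis using that by (simp add: W_def)
        qed
        show "(\<lambda>i. \<Sum>j\<in>I. A i j * w j) \<in> W" if "w \<in> W" for w
        proof -
          have "(\<Sum>i\<in>I. cnj (u l i) * (\<Sum>j\<in>I. A i j * w j)) = 0" if l: "l \<in> J" for l
          proof -
            have "(\<Sum>i\<in>I. cnj (u l i) * (\<Sum>j\<in>I. A i j * w j)) = (\<Sum>i\<in>I. of_real (b l) * (cnj (u l i) * w i))"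
              unfolding hermitian_inner_move[OF A]
              by (rule sum.cong[OF refl]) (use l e in \<open>simp del: cnj_sum add: e\<close>)
            also have "\<dots> = 0"
              using \<open>w \<in> W\<close> l by (simp add: W_def sum_distrib_left[symmetric])
            finally show ?thesis .
          qed
          then show ?thesis by (simp add: W_def)
        qed
      qed
      then obtain z w where w: "w \<in> W" "\<exists>i\<in>I. w i \<noteq> 0" "\<And>i. i \<in> I \<Longrightarrow> (\<Sum>j\<in>I. A i j * w j) = z * w i"
        by blast
      define s where "s = (\<Sum>i\<in>I. (cmod (w i))\<^sup>2)"
      have "s \<noteq> 0" unfolding s_def
        using w(2) fin by (subst sum_nonneg_eq_0_iff) auto
      moreover have "s \<ge> 0" unfolding s_def by (rule sum_nonneg) auto
      ultimately have s: "s > 0" by simp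
      \<comment> \<open>Evaluating the inner product of \<open>w\<close> and \<open>A w\<close> from
        both sides shows that the eigenvalue is real.\<close>
      have "z * s = cnj z * s"
        using hermitian_inner_move[OF A, of w w] w(3) cnj_mult_self_sum[of w I]
        by (simp add: s_def algebra_simps sum_distrib_left[symmetric] del: cnj_sum of_real_sum)
      then have "z = cnj z" using s by simp
      then have z: "z = of_real (Re z)" by (simp add: complex_eq_iff)
      define u' where "u' = u(m := (\<lambda>i. w i / of_real (sqrt s)))"
      have u'J: "u' l = u l" if "l \<in> J" for l using that insert.hyps by (auto simp: u'_def)
      have "orthonormal I (insert m J) u'"
      proof -
        have 1: "(\<Sum>i\<in>I. cnj (u' m i) * u' m i) = 1"
        proof -
          have "(\<Sum>i\<in>I. cnj (u' m i) * u' m i) = (\<Sum>i\<in>I. (cnj (w i) * w i) / of_real s)"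
          proof (rule sum.cong[OF refl])
            fix i
            have "complex_of_real (sqrt s) * of_real (sqrt s) = of_real s"
              using s by (simp flip: of_real_mult)
            then show "cnj (u' m i) * u' m i = (cnj (w i) * w i) / of_real s"
              by (simp add: u'_def)
          qed
          also have "\<dots> = 1" using s
            unfolding sum_divide_distrib[symmetric] cnj_mult_self_sum by (simp add: s_def[symmetric] del: of_real_sum)
          finally show ?thesis .
        qed
        have 2: "(\<Sum>i\<in>I. cnj (u' l i) * u' m i) = 0" if "l \<in> J" for l
        proof -
          have "(\<Sum>i\<in>I. cnj (u' l i) * u' m i) = (\<Sum>i\<in>I. cnj (u l i) * w i) / of_real (sqrt s)"
            using that by (simp add: u'J) (simp add: u'_def sum_divide_distrib)
          then show ?thesis using w(1) that by (simp add: W_def)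
        qed
        have 3: "(\<Sum>i\<in>I. cnj (u' m i) * u' l i) = 0" if "l \<in> J" for l
        proof -
          have "(\<Sum>i\<in>I. cnj (u' m i) * u' l i) = cnj (\<Sum>i\<in>I. cnj (u' l i) * u' m i)"
            by (simp add: mult.commute)
          then show ?thesis using 2[OF that] by simp
        qed
        show ?thesis
          unfolding orthonormal_def using 1 2 3 o insert.hyps(2) u'J
          by (auto simp: orthonormal_def)
      qed
      moreover have "(\<Sum>j\<in>I. A i j * u' l j) = of_real ((b(m := Re z)) l) * u' l i"
        if "l \<in> insert m J" "i \<in> I" for l i
      proof (cases "l = m")
        case True
        have "(\<Sum>j\<in>I. A i j * u' m j) = (\<Sum>j\<in>I. A i j * w j) / of_real (sqrt s)"
          by (simp add: u'_def sum_divide_distrib)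
        then show ?thesis using w(3)[OF that(2)] True z by (simp add: u'_def)
      next
        case False
        then show ?thesis using that e u'J by auto
      qed
      ultimately show ?case by blast
    qed
  qed
  then show ?thesis by blast
qed

lemma hermitian_spectral:
  fixes A :: "'i cmat"
  assumes fin: "finite I" and A: "hermitian I A"
  obtains u b where "orthonormal I I u" "A = spectral_sum I u b"
proof -
  obtain u b where o: "orthonormal I I u"
    and e: "\<And>m i. m \<in> I \<Longrightarrow> i \<in> I \<Longrightarrow> (\<Sum>j\<in>I. A i j * u m j) = of_real (b m) * u m i"
    using hermitian_eigenbasis[OF assms] by blast
  have "A i j = spectral_sum I u b i j" for i j
  proof (cases "i \<in> I \<and> j \<in> I")
    case True
    have "(\<Sum>m\<in>I. of_real (b m) * u m i * cnj (u m j)) = (\<Sum>m\<in>I. (\<Sum>k\<in>I. A i k * u m k) * cnj (u m j))"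
      using True e by simp
    also have "\<dots> = (\<Sum>k\<in>I. A i k * (\<Sum>m\<in>I. u m k * cnj (u m j)))"
      by (simp add: sum_distrib_left sum_distrib_right, subst sum.swap) (simp add: algebra_simps)
    also have "\<dots> = (\<Sum>k\<in>I. if k = j then A i j else 0)"
      by (rule sum.cong) (use True orthonormal_completeness[OF fin o] in auto)
    also have "\<dots> = A i j" using True fin by simp
    finally show ?thesis using True by (simp add: spectral_sum_def)
  next
    case False
    then show ?thesis using A by (auto simp: spectral_sum_def hermitian_def mats_def)
  qed
  then show ?thesis using that o by blast
qed

section \<open>Functional calculus, exponential and logarithm\<close>

lemma spectral_sum_mult:
  assumes fin: "finite I" and o: "orthonormal I I u"
  shows "mmult I (spectral_sum I u f) (spectral_sum I u g) = spectral_sum I u (\<lambda>m. f m * g m)"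
proof (intro ext)
  fix i j
  show "mmult I (spectral_sum I u f) (spectral_sum I u g) i j = spectral_sum I u (\<lambda>m. f m * g m) i j"
  proof (cases "i \<in> I \<and> j \<in> I")
    case True
    have "mmult I (spectral_sum I u f) (spectral_sum I u g) i j
       = (\<Sum>k\<in>I. \<Sum>m\<in>I. \<Sum>l\<in>I. (of_real (f m) * u m i * cnj (u m k)) * (of_real (g l) * u l k * cnj (u l j)))"
      using True by (simp add: mmult_def spectral_sum_def sum_product)
    also have "\<dots> = (\<Sum>m\<in>I. \<Sum>l\<in>I. \<Sum>k\<in>I. (of_real (f m) * u m i * cnj (u m k)) * (of_real (g l) * u l k * cnj (u l j)))"
      by (subst sum.swap, rule sum.cong[OF refl], rule sum.swap)
    also have "\<dots> = (\<Sum>m\<in>I. \<Sum>l\<in>I. of_real (f m * g l) * u m i * cnj (u l j) * (\<Sum>k\<in>I. cnj (u m k) * u l k))"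
      by (simp add: sum_distrib_left algebra_simps)
    also have "\<dots> = (\<Sum>m\<in>I. \<Sum>l\<in>I. if l = m then of_real (f m * g m) * u m i * cnj (u m j) else 0)"
      by (intro sum.cong refl) (use o in \<open>auto simp: orthonormal_def\<close>)
    also have "\<dots> = (\<Sum>m\<in>I. of_real (f m * g m) * u m i * cnj (u m j))"
      using fin by simp
    finally show ?thesis using True by (simp add: spectral_sum_def)
  next
    case False
    then show ?thesis by (auto simp: mmult_def spectral_sum_def)
  qed
qed

lemma spectral_sum_one:
  assumes "finite I" "orthonormal I I u"
  shows "spectral_sum I u (\<lambda>_. 1) = mone I"
  by (intro ext) (auto simp: spectral_sum_def mone_def orthonormal_completeness[OF assms])

lemma spectral_sum_trace:
  assumes o: "orthonormal I I u"
  shows "mtrace I (spectral_sum I u f) = of_real (\<Sum>m\<in>I. f m)"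
proof -
  have "mtrace I (spectral_sum I u f) = (\<Sum>m\<in>I. of_real (f m) * (\<Sum>i\<in>I. cnj (u m i) * u m i))"
    by (simp add: mtrace_def spectral_sum_def sum_distrib_left, subst sum.swap)
       (simp add: algebra_simps)
  also have "\<dots> = (\<Sum>m\<in>I. of_real (f m))"
    by (rule sum.cong) (use o in \<open>auto simp: orthonormal_def\<close>)
  finally show ?thesis by simp
qed

lemma spectral_sum_hermitian: "hermitian I (spectral_sum I u f)"
  by (auto simp: hermitian_def mats_def madj_def spectral_sum_def intro!: ext sum.cong)

lemma spectral_sum_scale: "mscale (of_real c) (spectral_sum I u f) = spectral_sum I u (\<lambda>m. c * f m)"
  by (intro ext) (simp add: mscale_def spectral_sum_def sum_distrib_left algebra_simps)

lemma spectral_sum_add: "madd (spectral_sum I u f) (spectral_sum I u g) = spectral_sum I u (\<lambda>m. f m + g m)"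
  by (intro ext) (simp add: madd_def spectral_sum_def sum.distrib algebra_simps)

lemma spectral_sum_mexp:
  assumes fin: "finite I" and o: "orthonormal I I u"
  shows "mexp I (spectral_sum I u f) = spectral_sum I u (\<lambda>m. exp (f m))"
proof (intro ext)
  fix i j
  have pow: "mpow I (spectral_sum I u f) k = spectral_sum I u (\<lambda>m. f m ^ k)" for k
    by (induction k) (simp_all add: mpow_def spectral_sum_one[OF assms] spectral_sum_mult[OF assms])
  show "mexp I (spectral_sum I u f) i j = spectral_sum I u (\<lambda>m. exp (f m)) i j"
  proof (cases "i \<in> I \<and> j \<in> I")
    case True
    have "(\<lambda>k. \<Sum>m\<in>I. of_real (f m ^ k /\<^sub>R fact k) * u m i * cnj (u m j)) sums
       (\<Sum>m\<in>I. of_real (exp (f m)) * u m i * cnj (u m j))"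
      by (intro sums_sum sums_mult2 sums_of_real exp_converges)
    moreover have "mpow I (spectral_sum I u f) k i j / of_nat (fact k)
       = (\<Sum>m\<in>I. of_real (f m ^ k /\<^sub>R fact k) * u m i * cnj (u m j))" for k
      using True unfolding pow by (simp add: spectral_sum_def sum_distrib_left sum_divide_distrib divide_inverse algebra_simps)
    ultimately show ?thesis using True
      by (simp add: mexp_def sums_iff) (simp add: spectral_sum_def)
  next
    case False
    then show ?thesis by (auto simp: mexp_def pow) (auto simp: spectral_sum_def)
  qed
qed

text \<open>A diagonalised matrix between \<open>u m\<close> and \<open>v l\<close> can be evaluated
  at whichever of the two is its eigenvector. If one matrix is diagonalised in both bases, this
  yields two values for the same number.\<close>

lemma spectral_sum_coeff:
  assumes fin: "finite I" and o: "orthonormal I I u" and v: "orthonormal I I v" and m: "m \<in> I" and l: "l \<in> I"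
  shows "(\<Sum>i\<in>I. \<Sum>j\<in>I. cnj (u m i) * spectral_sum I u f i j * v l j)
            = of_real (f m) * (\<Sum>j\<in>I. cnj (u m j) * v l j)"
    and "(\<Sum>i\<in>I. \<Sum>j\<in>I. cnj (u m i) * spectral_sum I v g i j * v l j)
            = of_real (g l) * (\<Sum>i\<in>I. cnj (u m i) * v l i)"
proof -
  have left: "(\<Sum>i\<in>I. cnj (u m i) * spectral_sum I u f i j) = of_real (f m) * cnj (u m j)" if "j \<in> I" for j
  proof -
    have "(\<Sum>i\<in>I. cnj (u m i) * spectral_sum I u f i j)
      = (\<Sum>k\<in>I. of_real (f k) * cnj (u k j) * (\<Sum>i\<in>I. cnj (u m i) * u k i))"
      using that by (simp add: spectral_sum_def sum_distrib_left, subst sum.swap) (simp add: algebra_simps)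
    also have "\<dots> = (\<Sum>k\<in>I. if k = m then of_real (f m) * cnj (u m j) else 0)"
      by (rule sum.cong) (use o m in \<open>auto simp: orthonormal_def\<close>)
    finally show ?thesis using m fin by simp
  qed
  have right: "(\<Sum>j\<in>I. spectral_sum I v g i j * v l j) = of_real (g l) * v l i" if "i \<in> I" for i
  proof -
    have "(\<Sum>j\<in>I. spectral_sum I v g i j * v l j)
      = (\<Sum>k\<in>I. of_real (g k) * v k i * (\<Sum>j\<in>I. cnj (v k j) * v l j))"
      using that by (simp add: spectral_sum_def sum_distrib_left sum_distrib_right, subst sum.swap) (simp add: algebra_simps)
    also have "\<dots> = (\<Sum>k\<in>I. if k = l then of_real (g l) * v l i else 0)"
      by (rule sum.cong) (use v l in \<open>auto simp: orthonormal_def\<close>)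
    finally show ?thesis using l fin by simp
  qed
  have "(\<Sum>i\<in>I. \<Sum>j\<in>I. cnj (u m i) * spectral_sum I u f i j * v l j)
      = (\<Sum>j\<in>I. (\<Sum>i\<in>I. cnj (u m i) * spectral_sum I u f i j) * v l j)"
    by (subst sum.swap) (simp add: sum_distrib_right)
  then show "(\<Sum>i\<in>I. \<Sum>j\<in>I. cnj (u m i) * spectral_sum I u f i j * v l j)
            = of_real (f m) * (\<Sum>j\<in>I. cnj (u m j) * v l j)"
    by (simp add: left sum_distrib_left algebra_simps)
  have "(\<Sum>i\<in>I. \<Sum>j\<in>I. cnj (u m i) * spectral_sum I v g i j * v l j)
      = (\<Sum>i\<in>I. cnj (u m i) * (\<Sum>j\<in>I. spectral_sum I v g i j * v l j))"
    by (simp add: sum_distrib_left mult.assoc)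
  also have "\<dots> = of_real (g l) * (\<Sum>i\<in>I. cnj (u m i) * v l i)"
    by (simp add: right sum_distrib_left mult.left_commute)
  finally show "(\<Sum>i\<in>I. \<Sum>j\<in>I. cnj (u m i) * spectral_sum I v g i j * v l j)
            = of_real (g l) * (\<Sum>i\<in>I. cnj (u m i) * v l i)" .
qed

text \<open>Equality of the exponentials forces \<open>f m = g l\<close> whenever \<open>u m\<close> and \<open>v l\<close> are not orthogonal.\<close>
lemma spectral_sum_exp_inj:
  assumes fin: "finite I" and o: "orthonormal I I u" and v: "orthonormal I I v"
    and eq: "spectral_sum I u (\<lambda>m. exp (f m)) = spectral_sum I v (\<lambda>m. exp (g m))"
  shows "spectral_sum I u f = spectral_sum I v g"
proof (intro ext)
  fix i j
  have ml: "of_real (f m) * (\<Sum>i\<in>I. cnj (u m i) * v l i) = of_real (g l) * (\<Sum>i\<in>I. cnj (u m i) * v l i)"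
    if "m \<in> I" "l \<in> I" for m l
  proof -
    have "complex_of_real (exp (f m)) * (\<Sum>i\<in>I. cnj (u m i) * v l i) = of_real (exp (g l)) * (\<Sum>i\<in>I. cnj (u m i) * v l i)"
      by (rule trans[OF sym[OF spectral_sum_coeff(1)[OF fin o v that, of "\<lambda>m. exp (f m)"]]])
         (simp only: eq spectral_sum_coeff(2)[OF fin o v that])
    then have "(\<Sum>i\<in>I. cnj (u m i) * v l i) = 0 \<or> exp (f m) = exp (g l)"
      unfolding mult_cancel_right of_real_eq_iff by blast
    then show ?thesis by auto
  qed
  show "spectral_sum I u f i j = spectral_sum I v g i j"
  proof (cases "i \<in> I \<and> j \<in> I")
    case True
    \<comment> \<open>Both spectral sums are rewritten over the mixed products of \<open>u m\<close>
      and the conjugate of \<open>v l\<close>, where \<open>ml\<close> compares them term by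
      term.\<close>
    have expand: "(\<Sum>m\<in>I. h m * u m i * cnj (u m j))
       = (\<Sum>m\<in>I. \<Sum>l\<in>I. u m i * cnj (v l j) * (h m * (\<Sum>k\<in>I. cnj (u m k) * v l k)))" for h
    proof -
      have "cnj (u m j) = (\<Sum>l\<in>I. cnj (v l j) * (\<Sum>k\<in>I. cnj (u m k) * v l k))" for m
      proof -
        have "(\<Sum>l\<in>I. cnj (v l j) * (\<Sum>k\<in>I. cnj (u m k) * v l k))
          = (\<Sum>k\<in>I. cnj (u m k) * (\<Sum>l\<in>I. v l k * cnj (v l j)))"
          by (simp add: sum_distrib_left, subst sum.swap) (simp add: algebra_simps)
        also have "\<dots> = (\<Sum>k\<in>I. if k = j then cnj (u m j) else 0)"
          by (rule sum.cong) (use True orthonormal_completeness[OF fin v] in auto)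
        finally show ?thesis using True fin by simp
      qed
      then show ?thesis by (simp add: sum_distrib_left algebra_simps)
    qed
    have expand': "(\<Sum>l\<in>I. h l * v l i * cnj (v l j))
       = (\<Sum>m\<in>I. \<Sum>l\<in>I. u m i * cnj (v l j) * (h l * (\<Sum>k\<in>I. cnj (u m k) * v l k)))" for h
    proof -
      have "v l i = (\<Sum>m\<in>I. u m i * (\<Sum>k\<in>I. cnj (u m k) * v l k))" for l
      proof -
        have "(\<Sum>m\<in>I. u m i * (\<Sum>k\<in>I. cnj (u m k) * v l k))
          = (\<Sum>k\<in>I. v l k * (\<Sum>m\<in>I. u m i * cnj (u m k)))"
          by (simp add: sum_distrib_left, subst sum.swap) (simp add: algebra_simps)
        also have "\<dots> = (\<Sum>k\<in>I. if k = i then v l i else 0)"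
          by (rule sum.cong) (use True orthonormal_completeness[OF fin o] in auto)
        finally show ?thesis using True fin by simp
      qed
      then have "(\<Sum>l\<in>I. h l * v l i * cnj (v l j))
         = (\<Sum>l\<in>I. \<Sum>m\<in>I. u m i * cnj (v l j) * (h l * (\<Sum>k\<in>I. cnj (u m k) * v l k)))"
        by (simp add: sum_distrib_left sum_distrib_right algebra_simps)
      then show ?thesis by (subst (asm) sum.swap)
    qed
    have "(\<Sum>m\<in>I. of_real (f m) * u m i * cnj (u m j)) = (\<Sum>l\<in>I. of_real (g l) * v l i * cnj (v l j))"
      unfolding expand[of "\<lambda>m. of_real (f m)"] expand'[of "\<lambda>l. of_real (g l)"]
      by (intro sum.cong refl) (simp only: ml)
    then show ?thesis using True by (simp add: spectral_sum_def)
  qed (auto simp: spectral_sum_def)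
qed

text \<open>The description in \<open>mlog\<close> needs uniqueness: a competitor \<open>B\<close>
  is diagonalised in its own basis, and injectivity of the exponential across bases identifies
  it.\<close>

lemma spectral_sum_mlog:
  assumes fin: "finite I" and o: "orthonormal I I u" and pos: "\<And>m. m \<in> I \<Longrightarrow> a m > 0"
  shows "mlog I (spectral_sum I u a) = spectral_sum I u (\<lambda>m. ln (a m))"
proof -
  have a: "spectral_sum I u (\<lambda>m. exp (ln (a m))) = spectral_sum I u a"
    using pos by (auto simp: spectral_sum_def intro!: ext sum.cong)
  show ?thesis unfolding mlog_def
  proof (rule the_equality)
    show "hermitian I (spectral_sum I u (\<lambda>m. ln (a m))) \<and> mexp I (spectral_sum I u (\<lambda>m. ln (a m))) = spectral_sum I u a"
      by (simp add: spectral_sum_hermitian spectral_sum_mexp[OF fin o] a)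
    fix B assume B: "hermitian I B \<and> mexp I B = spectral_sum I u a"
    obtain v c where v: "orthonormal I I v" "B = spectral_sum I v c"
      using hermitian_spectral[OF fin] B by blast
    have "spectral_sum I u (\<lambda>m. exp (ln (a m))) = spectral_sum I v (\<lambda>m. exp (c m))"
      using B v spectral_sum_mexp[OF fin v(1)] a by simp
    from spectral_sum_exp_inj[OF fin o v(1) this]
    show "B = spectral_sum I u (\<lambda>m. ln (a m))" using v by simp
  qed
qed

text \<open>Up to a positive factor, \<open>ent2\<close> is the relative entropy of the distribution
  \<open>a m = x m * x m / s\<close> with respect to the uniform one. The bound ln t \<le> t - 1 at
  t = 1 / (a m * D) makes each summand at least a m - 1 / D, and these lower bounds sum to
  0.\<close>

lemma ent2_nonneg:
  assumes fin: "finite I" and ne: "I \<noteq> {}" and X: "posdef I X"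
  shows "ent2 I X \<ge> 0"
proof -
  obtain u x where o: "orthonormal I I u" and Xs: "X = spectral_sum I u x"
    using hermitian_spectral[OF fin] X by (auto simp: posdef_def)
  have x: "x m > 0" if m: "m \<in> I" for m
  proof -
    have one: "(\<Sum>i\<in>I. cnj (u m i) * u m i) = 1" using o m by (auto simp: orthonormal_def)
    then have "\<exists>i\<in>I. u m i \<noteq> 0" by (auto intro: ccontr)
    \<comment> \<open>The quadratic form at a unit eigenvector returns the eigenvalue.\<close>
    moreover have "qform I X (u m) = of_real (x m)"
      unfolding qform_def Xs spectral_sum_coeff(1)[OF fin o o m m] one by simp
    ultimately show ?thesis using X by (auto simp: posdef_def)
  qed
  define s where "s = (\<Sum>m\<in>I. x m * x m)"
  have s: "s > 0" unfolding s_def using x by (intro sum_pos fin ne) auto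
  define D where "D = real (card I)"
  have D: "D > 0" unfolding D_def using fin ne by (simp add: card_gt_0_iff)
  define a where "a = (\<lambda>m. x m * x m / s)"
  have a: "a m > 0" if "m \<in> I" for m using x[OF that] s by (simp add: a_def)
  have suma: "(\<Sum>m\<in>I. a m) = 1"
    using s by (simp add: a_def sum_divide_distrib[symmetric] s_def)
  have X2: "mmult I X X = spectral_sum I u (\<lambda>m. x m * x m)"
    unfolding Xs by (rule spectral_sum_mult[OF fin o])
  have tr: "mtrace I (mmult I X X) = of_real s" unfolding X2 spectral_sum_trace[OF o] s_def by simp
  have sc: "mscale (1 / mtrace I (mmult I X X)) (mmult I X X) = spectral_sum I u a"
    unfolding X2 tr[unfolded X2] using spectral_sum_scale[of "1/s" I u] by (simp add: a_def)
  have one: "mscale (of_real (ln D)) (mone I) = spectral_sum I u (\<lambda>m. ln D)"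
    using spectral_sum_scale[of "ln D" I u "\<lambda>_. 1"] spectral_sum_one[OF fin o] by simp
  have ml: "mlog I (spectral_sum I u a) = spectral_sum I u (\<lambda>m. ln (a m))"
    by (rule spectral_sum_mlog[OF fin o a])
  have "ent2 I X = (\<Sum>m\<in>I. x m * x m * (ln (a m) + ln D)) / (2 * D)"
    unfolding ent2_def Let_def sc ml D_def[symmetric] one spectral_sum_add
    unfolding X2 spectral_sum_mult[OF fin o] spectral_sum_trace[OF o] by simp
  also have "(\<Sum>m\<in>I. x m * x m * (ln (a m) + ln D)) = s * (\<Sum>m\<in>I. a m * (ln (a m) + ln D))"
    using s by (simp add: a_def sum_distrib_left)
  also have "(\<Sum>m\<in>I. a m * (ln (a m) + ln D)) \<ge> (\<Sum>m\<in>I. a m - 1 / D)"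
  proof (rule sum_mono)
    fix m assume m: "m \<in> I"
    have "ln (1 / (a m * D)) \<le> 1 / (a m * D) - 1"
      using a[OF m] D by (intro ln_le_minus_one) simp
    moreover have "ln (1 / (a m * D)) = - (ln (a m) + ln D)"
      using a[OF m] D by (simp add: ln_div ln_mult)
    ultimately have "a m * (1 - 1 / (a m * D)) \<le> a m * (ln (a m) + ln D)"
      using a[OF m] by (intro mult_left_mono) auto
    moreover have "a m * (1 - 1 / (a m * D)) = a m - 1 / D"
      using a[OF m] D by (simp add: field_simps)
    ultimately show "a m - 1 / D \<le> a m * (ln (a m) + ln D)" by simp
  qed
  moreover have "(\<Sum>m\<in>I. a m - 1 / D) = 0"
    using suma D by (simp add: sum_subtractf D_def)
  ultimately show ?thesis using s D by simp
qed

subsection \<open>Liouvillians and the Hilbert--Schmidt inner product\<close>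

definition hs_ip :: "'i set \<Rightarrow> 'i cmat \<Rightarrow> 'i cmat \<Rightarrow> complex" where
  "hs_ip I X Y = (\<Sum>i\<in>I. \<Sum>j\<in>I. cnj (X i j) * Y i j)"

lemma hs_ip_lin_right:
  "hs_ip I X (\<lambda>i j. a * Y i j + b * Z i j) = a * hs_ip I X Y + b * hs_ip I X Z"
  by (simp add: hs_ip_def algebra_simps sum.distrib sum_distrib_left)

lemma hs_ip_lin_left:
  "hs_ip I (\<lambda>i j. a * Y i j + b * Z i j) X = cnj a * hs_ip I Y X + cnj b * hs_ip I Z X"
  by (simp add: hs_ip_def algebra_simps sum.distrib sum_distrib_left)

lemma cnj_hs_ip: "cnj (hs_ip I X Y) = hs_ip I Y X"
  by (simp add: hs_ip_def mult.commute)

lemma hs_ip_self: "hs_ip I X X = of_real ((hs_norm I X)\<^sup>2)"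
proof -
  have "0 \<le> (\<Sum>i\<in>I. \<Sum>j\<in>I. (cmod (X i j))\<^sup>2)" by (intro sum_nonneg) auto
  then show ?thesis by (simp add: hs_ip_def hs_norm_def cnj_mult_self_sum)
qed

lemma hs_ip_hermitian_real:
  assumes "hermitian I X" "hermitian I Y"
  shows "Im (hs_ip I X Y) = 0"
proof -
  have "cnj (hs_ip I X Y) = (\<Sum>i\<in>I. \<Sum>j\<in>I. cnj (X j i) * Y j i)"
    by (simp add: hs_ip_def hermitian_sym[OF assms(1)] hermitian_sym[OF assms(2)])
  also have "\<dots> = hs_ip I X Y" unfolding hs_ip_def by (rule sum.swap)
  finally show ?thesis by (simp add: complex_eq_iff)
qed

lemma mtrace_mmult_hermitian:
  "hermitian I X \<Longrightarrow> mtrace I (mmult I A X) = hs_ip I X A"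
  by (simp add: mtrace_def mmult_def hs_ip_def hermitian_sym mult.commute)

lemma hs_norm_L2_set: "hs_norm I X = L2_set (\<lambda>p. cmod (X (fst p) (snd p))) (I \<times> I)"
  by (simp add: hs_norm_def L2_set_def sum.cartesian_product case_prod_unfold)

lemma hs_norm_nonneg: "0 \<le> hs_norm I X"
  by (simp add: hs_norm_L2_set)

lemma hs_norm_scale: "hs_norm I (\<lambda>i j. c * X i j) = cmod c * hs_norm I X"
  by (simp add: hs_norm_L2_set norm_mult L2_set_right_distrib)

lemma hs_norm_entry:
  assumes "finite I" "i \<in> I" "j \<in> I"
  shows "cmod (X i j) \<le> hs_norm I X"
  unfolding hs_norm_L2_set
  using member_le_L2_set[of "I \<times> I" "(i, j)" "\<lambda>p. cmod (X (fst p) (snd p))"] assms by simp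

lemma hs_norm_le_sum: "hs_norm I X \<le> (\<Sum>i\<in>I. \<Sum>j\<in>I. cmod (X i j))"
  using L2_set_le_sum[of "I \<times> I" "\<lambda>p. cmod (X (fst p) (snd p))"]
  by (simp add: hs_norm_L2_set sum.cartesian_product case_prod_unfold)

lemma hs_ip_cauchy_schwarz: "cmod (hs_ip I X Y) \<le> hs_norm I X * hs_norm I Y"
proof -
  have "cmod (hs_ip I X Y) = cmod (\<Sum>p\<in>I \<times> I. cnj (X (fst p) (snd p)) * Y (fst p) (snd p))"
    by (simp add: hs_ip_def sum.cartesian_product case_prod_unfold)
  also have "\<dots> \<le> (\<Sum>p\<in>I \<times> I. \<bar>cmod (X (fst p) (snd p))\<bar> * \<bar>cmod (Y (fst p) (snd p))\<bar>)"
    by (rule sum_norm_le) (simp add: norm_mult)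
  also have "\<dots> \<le> hs_norm I X * hs_norm I Y"
    unfolding hs_norm_L2_set by (rule L2_set_mult_ineq)
  finally show ?thesis .
qed

section \<open>Linear superoperators and the derivative of the semigroup\<close>

lemma mats_lin: "X \<in> mats I \<Longrightarrow> Y \<in> mats I \<Longrightarrow> (\<lambda>i j. a * X i j + b * Y i j) \<in> mats I"
  by (auto simp: mats_def)

lemma mone_mats: "mone I \<in> mats I"
  by (auto simp: mats_def mone_def)

lemma hermitian_mone: "hermitian I (mone I)"
  using mone_mats[of I] by (auto simp: hermitian_def madj_def mone_def intro!: ext)

lemma munit_mats: "r \<in> I \<Longrightarrow> s \<in> I \<Longrightarrow> munit r s \<in> mats I"
  by (auto simp: mats_def munit_def)

lemma sop_on_mats: "sop_on I L \<Longrightarrow> X \<in> mats I \<Longrightarrow> L X \<in> mats I"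
  by (simp add: sop_on_def)

lemma sop_on_lin:
  assumes "sop_on I L" "X \<in> mats I" "Y \<in> mats I"
  shows "L (\<lambda>i j. a * X i j + b * Y i j) = (\<lambda>i j. a * L X i j + b * L Y i j)"
  using assms by (simp add: sop_on_def madd_def mscale_def)

lemma sop_on_scale:
  assumes "sop_on I L" "X \<in> mats I"
  shows "L (\<lambda>i j. a * X i j) = (\<lambda>i j. a * L X i j)"
  using sop_on_lin[OF assms(1) assms(2) assms(2), of a 0] by simp

lemma sop_on_sum:
  assumes L: "sop_on I L" and "finite K" and Z: "\<And>k. k \<in> K \<Longrightarrow> Z k \<in> mats I"
  shows "L (\<lambda>i j. \<Sum>k\<in>K. c k * Z k i j) = (\<lambda>i j. \<Sum>k\<in>K. c k * L (Z k) i j)"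
  using assms(2) Z
proof (induction K rule: finite_induct)
  case empty
  have "(\<lambda>i j. 0) \<in> mats I" by (simp add: mats_def)
  from sop_on_scale[OF L this, of 0] show ?case by simp
next
  case (insert k K)
  have "(\<lambda>i j. \<Sum>k\<in>K. c k * Z k i j) \<in> mats I"
    using insert.prems by (auto simp: mats_def)
  from sop_on_lin[OF L _ this, of "Z k" "c k" 1] insert show ?case by simp
qed

lemma sop_on_expand:
  assumes L: "sop_on I L" and fin: "finite I" and X: "X \<in> mats I"
  shows "L X i j = (\<Sum>r\<in>I. \<Sum>s\<in>I. X r s * L (munit r s) i j)"
proof -
  have "X = (\<lambda>i j. \<Sum>k\<in>I \<times> I. X (fst k) (snd k) * munit (fst k) (snd k) i j)"
  proof (intro ext)
    fix i j
    have "(\<Sum>k\<in>I \<times> I. X (fst k) (snd k) * munit (fst k) (snd k) i j)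
      = (\<Sum>k\<in>I \<times> I. if k = (i, j) then X i j else 0)"
      by (rule sum.cong) (auto simp: munit_def)
    also have "\<dots> = X i j"
      using fin X by (auto simp: mats_def)
    finally show "X i j = (\<Sum>k\<in>I \<times> I. X (fst k) (snd k) * munit (fst k) (snd k) i j)" by simp
  qed
  then have "L X = L (\<lambda>i j. \<Sum>k\<in>I \<times> I. X (fst k) (snd k) * munit (fst k) (snd k) i j)" by simp
  also have "\<dots> = (\<lambda>i j. \<Sum>k\<in>I \<times> I. X (fst k) (snd k) * L (munit (fst k) (snd k)) i j)"
    by (rule sop_on_sum[OF L]) (use fin in \<open>auto intro: munit_mats\<close>)
  finally show ?thesis by (simp add: sum.cartesian_product case_prod_unfold)
qed

text \<open>The sum of the moduli of all matrix coefficients of \<open>L\<close> serves as a crude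
  bound. It makes the exponential series converge and the set behind \<open>op_norm\<close>
  bounded.\<close>

lemma sop_on_bounded:
  assumes L: "sop_on I L" and fin: "finite I"
  obtains M where "M \<ge> 0"
    "\<And>X c i j. X \<in> mats I \<Longrightarrow> (\<And>r s. cmod (X r s) \<le> c) \<Longrightarrow> cmod (L X i j) \<le> M * c"
proof
  define M where "M = (\<Sum>i\<in>I. \<Sum>j\<in>I. \<Sum>r\<in>I. \<Sum>s\<in>I. cmod (L (munit r s) i j))"
  show "M \<ge> 0" unfolding M_def by (intro sum_nonneg) auto
  fix X c i j assume X: "X \<in> mats I" and c: "\<And>r s. cmod (X r s) \<le> c"
  have c0: "c \<ge> 0" using c[of undefined undefined] norm_ge_zero order.trans by blast
  show "cmod (L X i j) \<le> M * c"
  proof (cases "i \<in> I \<and> j \<in> I")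
    case True
    have "cmod (L X i j) \<le> (\<Sum>r\<in>I. \<Sum>s\<in>I. cmod (L (munit r s) i j) * c)"
      unfolding sop_on_expand[OF L fin X]
      by (intro sum_norm_le) (simp add: norm_mult mult.commute mult_right_mono c)
    also have "\<dots> = (\<Sum>r\<in>I. \<Sum>s\<in>I. cmod (L (munit r s) i j)) * c"
      by (simp add: sum_distrib_right)
    also have "\<dots> \<le> M * c"
    proof (rule mult_right_mono[OF _ c0])
      have "(\<Sum>r\<in>I. \<Sum>s\<in>I. cmod (L (munit r s) i j)) \<le> (\<Sum>j\<in>I. \<Sum>r\<in>I. \<Sum>s\<in>I. cmod (L (munit r s) i j))"
        by (rule member_le_sum) (use True fin in \<open>auto intro!: sum_nonneg\<close>)
      also have "\<dots> \<le> M" unfolding M_def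
        by (rule member_le_sum) (use True fin in \<open>auto intro!: sum_nonneg\<close>)
      finally show "(\<Sum>r\<in>I. \<Sum>s\<in>I. cmod (L (munit r s) i j)) \<le> M" .
    qed
    finally show ?thesis .
  next
    case False
    then have "L X i j = 0" using sop_on_mats[OF L X] by (auto simp: mats_def)
    then show ?thesis using c0 \<open>M \<ge> 0\<close> by simp
  qed
qed

text \<open>Each entry is a power series in t, dominated by an exponential series, whose linear
  coefficient is \<open>L X i j\<close>. The limit is one-sided because the semigroup properties are
  available only for t \<ge> 0.\<close>

lemma sop_exp_right_derivative:
  assumes L: "sop_on I L" and fin: "finite I" and X: "X \<in> mats I"
  shows "((\<lambda>t. (sop_exp I t L X i j - X i j) / of_real t) \<longlongrightarrow> L X i j) (at_right 0)"
proof -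
  obtain M where M: "M \<ge> 0"
    "\<And>X c i j. X \<in> mats I \<Longrightarrow> (\<And>r s. cmod (X r s) \<le> c) \<Longrightarrow> cmod (L X i j) \<le> M * c"
    using sop_on_bounded[OF L fin] by blast
  define C where "C = (\<Sum>i\<in>I. \<Sum>j\<in>I. cmod (X i j))"
  have XC: "cmod (X r s) \<le> C" for r s
  proof (cases "r \<in> I \<and> s \<in> I")
    case True
    then show ?thesis
      using hs_norm_entry[OF fin, of r s X] hs_norm_le_sum[of I X] by (simp add: C_def)
  next
    case False
    then have "X r s = 0" using X by (auto simp: mats_def)
    then show ?thesis unfolding C_def by (auto intro!: sum_nonneg)
  qed
  have iter: "(L ^^ k) X \<in> mats I \<and> (\<forall>r s. cmod ((L ^^ k) X r s) \<le> M ^ k * C)" for k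
  proof (induction k)
    case 0 then show ?case using X XC by simp
  next
    case (Suc k)
    then show ?case using M(2)[of "(L ^^ k) X" "M ^ k * C"] sop_on_mats[OF L]
      by (simp add: mult.assoc)
  qed
  define c where "c = (\<lambda>k. (L ^^ k) X i j / fact k)"
  \<comment> \<open>Convergence at 1 puts 0 strictly inside the disc of convergence, as termwise
    differentiation requires.\<close>
  have "summable (\<lambda>k. c k * 1 ^ k)"
  proof (rule summable_comparison_test')
    show "summable (\<lambda>k. inverse (fact k) * M ^ k * C)"
      by (intro summable_mult2 summable_exp)
    show "norm (c k * 1 ^ k) \<le> inverse (fact k) * M ^ k * C" if "k \<ge> 0" for k
    proof -
      have "norm (c k * 1 ^ k) = inverse (fact k) * cmod ((L ^^ k) X i j)"
        by (simp add: c_def norm_divide) (simp add: divide_inverse)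
      also have "\<dots> \<le> inverse (fact k) * (M ^ k * C)"
        using iter[of k] by (intro mult_left_mono) auto
      finally show ?thesis by (simp add: mult.assoc)
    qed
  qed
  from termdiffs_strong[OF this, of 0]
  have "((\<lambda>z. \<Sum>k. c k * z ^ k) has_field_derivative diffs c 0) (at 0)"
    by (simp add: powser_zero)
  then have d: "((\<lambda>z. ((\<Sum>k. c k * z ^ k) - c 0) / z) \<longlongrightarrow> L X i j) (at 0)"
    by (simp add: DERIV_def powser_zero) (simp add: diffs_def c_def)
  have r: "filterlim complex_of_real (at 0) (at_right 0)"
    by (auto simp: filterlim_at eventually_at_filter intro!: tendsto_eq_intros)
  have "(\<Sum>k. c k * of_real t ^ k) = sop_exp I t L X i j" for t
    by (simp add: sop_exp_def c_def mult.commute)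
  then show ?thesis using filterlim_compose[OF d r] by (simp add: c_def)
qed

section \<open>Kadison--Schwarz inequality\<close>

lemma sum_two_blocks:
  fixes f :: "nat \<times> 'i \<Rightarrow> 'a::comm_monoid_add"
  shows "(\<Sum>p\<in>{0..<2} \<times> I. f p) = (\<Sum>i\<in>I. f (0, i)) + (\<Sum>i\<in>I. f (1, i))"
  unfolding sum.cartesian_product' numeral_2_eq_2 by simp

text \<open>The block matrix with rows \<open>(X\<^sup>2, X)\<close> and \<open>(X, 1)\<close> factors as \<open>(X, 1)\<^sup>* (X, 1)\<close>.\<close>
definition ks_block :: "'i set \<Rightarrow> 'i cmat \<Rightarrow> nat \<Rightarrow> nat \<Rightarrow> 'i cmat" where
  "ks_block I X p q = (if p = 0 \<and> q = 0 then mmult I X X else if p = 1 \<and> q = 1 then mone I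
     else if p < 2 \<and> q < 2 then X else mzero)"

lemma mmult_mats: "X \<in> mats I \<Longrightarrow> Y \<in> mats I \<Longrightarrow> mmult I X Y \<in> mats I"
  by (auto simp: mats_def mmult_def)

lemma hermitian_square:
  assumes "hermitian I X"
  shows "hermitian I (mmult I X X)"
  using assms mmult_mats[of X I X]
  by (auto simp: hermitian_def madj_def mmult_def hermitian_sym[OF assms] mult.commute intro!: ext)

lemma psd_ks_block:
  assumes fin: "finite I" and X: "hermitian I X"
  shows "psd ({0..<2} \<times> I) (\<lambda>a b. ks_block I X (fst a) (fst b) (snd a) (snd b))" (is "psd _ ?Y")
  unfolding psd_def
proof
  have Xm: "X \<in> mats I" using X by (simp add: hermitian_def)
  have "ks_block I X p q \<in> mats I" for p q
    using Xm mmult_mats[OF Xm Xm] mone_mats[of I] by (auto simp: ks_block_def mats_def mzero_def)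
  moreover have "ks_block I X p q = mzero" if "\<not> p < 2 \<or> \<not> q < 2" for p q
    using that by (auto simp: ks_block_def)
  ultimately have "?Y (p, i) (q, j) = 0" if "\<not> (p < 2 \<and> i \<in> I) \<or> \<not> (q < 2 \<and> j \<in> I)" for p q i j
    using that by (cases "p < 2 \<and> q < 2") (auto simp: mats_def mzero_def)
  then have "?Y \<in> mats ({0..<2} \<times> I)"
    by (auto simp: mats_def)
  moreover have "cnj (ks_block I X q p j i) = ks_block I X p q i j" for p q i j
    by (simp add: ks_block_def hermitian_sym[OF X] hermitian_sym[OF hermitian_mone]
        hermitian_sym[OF hermitian_square[OF X]]) (simp add: mzero_def)
  ultimately show "hermitian ({0..<2} \<times> I) ?Y"
    by (simp add: hermitian_def madj_def)
  show "\<forall>v. 0 \<le> Re (qform ({0..<2} \<times> I) ?Y v)"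
  proof
    fix v :: "nat \<times> 'a \<Rightarrow> complex"
    define a where "a = (\<lambda>i. v (0, i))"
    define b where "b = (\<lambda>i. v (1, i))"
    have ab: "v (0, i) = a i" "v (Suc 0, i) = b i" for i by (simp_all add: a_def b_def)
    \<comment> \<open>With v = (a, b), the quadratic form of the block matrix is the squared norm of
      X a + b = \<open>w + b\<close>.\<close>
    define w where "w = (\<lambda>k. \<Sum>j\<in>I. X k j * a j)"
    have cw: "cnj (w k) = (\<Sum>i\<in>I. cnj (a i) * X i k)" for k
      by (simp add: w_def hermitian_sym[OF X] mult.commute)
    have 1: "(\<Sum>i\<in>I. \<Sum>j\<in>I. cnj (a i) * mmult I X X i j * a j) = (\<Sum>k\<in>I. cnj (w k) * w k)"
    proof -
      have "(\<Sum>i\<in>I. \<Sum>j\<in>I. cnj (a i) * mmult I X X i j * a j)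
         = (\<Sum>i\<in>I. \<Sum>k\<in>I. cnj (a i) * X i k * w k)"
        unfolding mmult_def w_def sum_distrib_left sum_distrib_right
        by (rule sum.cong[OF refl], subst sum.swap) (simp add: mult.assoc)
      then show ?thesis unfolding cw sum_distrib_right by (subst (asm) sum.swap)
    qed
    have 2: "(\<Sum>i\<in>I. \<Sum>j\<in>I. cnj (a i) * X i j * b j) = (\<Sum>k\<in>I. cnj (w k) * b k)"
      unfolding cw sum_distrib_right by (rule sum.swap)
    have 3: "(\<Sum>i\<in>I. \<Sum>j\<in>I. cnj (b i) * X i j * a j) = (\<Sum>k\<in>I. cnj (b k) * w k)"
      unfolding w_def sum_distrib_left by (simp add: mult.assoc)
    have 4: "(\<Sum>i\<in>I. \<Sum>j\<in>I. cnj (b i) * mone I i j * b j) = (\<Sum>k\<in>I. cnj (b k) * b k)"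
    proof (rule sum.cong[OF refl])
      fix i assume i: "i \<in> I"
      have "(\<Sum>j\<in>I. cnj (b i) * mone I i j * b j) = (\<Sum>j\<in>I. if j = i then cnj (b i) * b i else 0)"
        by (rule sum.cong) (auto simp: mone_def)
      then show "(\<Sum>j\<in>I. cnj (b i) * mone I i j * b j) = cnj (b i) * b i"
        using i fin by simp
    qed
    have "qform ({0..<2} \<times> I) ?Y v = (\<Sum>k\<in>I. cnj (w k + b k) * (w k + b k))"
      unfolding qform_def sum_two_blocks
      by (simp add: ks_block_def ab sum.distrib 1 2 3 4)
         (simp add: algebra_simps sum.distrib)
    also have "\<dots> = of_real (\<Sum>k\<in>I. (cmod (w k + b k))\<^sup>2)"
      by (rule cnj_mult_self_sum)
    finally show "0 \<le> Re (qform ({0..<2} \<times> I) ?Y v)"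
      by (simp add: sum_nonneg del: of_real_sum)
  qed
qed

text \<open>Complete positivity with k = 2 is applied to \<open>ks_block\<close>. Hermiticity of the
  image exchanges its two off-diagonal blocks, both equal to \<open>T X\<close>; positivity, tested
  on one vector per diagonal index, gives the trace inequality.\<close>

lemma
  assumes fin: "finite I" and cp: "completely_positive I T" and X: "hermitian I X"
  shows completely_positive_hermitian: "hermitian I (T X)"
    and kadison_schwarz_trace: "T (mone I) = mone I \<Longrightarrow>
      (hs_norm I (T X))\<^sup>2 \<le> Re (mtrace I (T (mmult I X X)))"
proof -
  let ?Y = "\<lambda>a b. ks_block I X (fst a) (fst b) (snd a) (snd b)"
  let ?Z = "ampl 2 T ?Y"
  have psd: "psd ({0..<2} \<times> I) ?Z"
    using cp psd_ks_block[OF fin X] unfolding completely_positive_def by blast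
  then have Zh: "hermitian ({0..<2} \<times> I) ?Z" by (simp add: psd_def)
  have Z: "?Z (p, i) (q, j) = T (ks_block I X p q) i j" if "p < 2" "q < 2" for p q i j
    using that by (simp add: ampl_def)
  have sym: "cnj (T X i j) = T X j i" for i j
    using hermitian_sym[OF Zh, of "(0, i)" "(1, j)"] by (simp add: Z) (simp add: ks_block_def)
  moreover have "T X \<in> mats I"
    unfolding mats_def
  proof (intro CollectI allI impI)
    fix i j assume "i \<notin> I \<or> j \<notin> I"
    then have "?Z (0, i) (1, j) = 0" using Zh by (auto simp: hermitian_def mats_def)
    then show "T X i j = 0" by (simp add: Z) (simp add: ks_block_def)
  qed
  ultimately show h: "hermitian I (T X)" by (simp add: hermitian_def madj_def)
  assume one: "T (mone I) = mone I"
  have diag: "(\<Sum>j\<in>I. (cmod (T X j m))\<^sup>2) \<le> Re (T (mmult I X X) m m)" if m: "m \<in> I" for m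
  proof -
    define q where "q = (\<lambda>i. T X i m)"
    \<comment> \<open>The test vector (e_m, - T X e_m): once the lower right block is the identity,
      this second component minimises the form for the first component e_m.\<close>
    define v where "v = (\<lambda>p::nat \<times> 'a. if fst p = 0 then (if snd p = m then 1 else 0) else - q (snd p))"
    have pick: "(\<Sum>i\<in>I. (if i = m then 1 else 0) * f i) = f m" for f :: "'a \<Rightarrow> complex"
      using m fin by (simp add: if_distrib[of "\<lambda>x. x * _"] cong: if_cong)
    have pick': "(\<Sum>i\<in>I. f i * (if i = m then 1 else 0)) = f m" for f :: "'a \<Rightarrow> complex"
      using pick[of f] by (simp add: mult.commute)
    have cpick: "cnj (if i = m then 1 else 0) = (if i = m then 1 else 0)" for i by simp
    have "qform ({0..<2} \<times> I) ?Z v = 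
       (\<Sum>i\<in>I. \<Sum>j\<in>I. cnj (v (0, i)) * T (mmult I X X) i j * v (0, j))
     + (\<Sum>i\<in>I. \<Sum>j\<in>I. cnj (v (0, i)) * T X i j * v (1, j))
     + ((\<Sum>i\<in>I. \<Sum>j\<in>I. cnj (v (1, i)) * T X i j * v (0, j))
     + (\<Sum>i\<in>I. \<Sum>j\<in>I. cnj (v (1, i)) * mone I i j * v (1, j)))"
      unfolding qform_def sum_two_blocks by (simp add: Z sum.distrib) (simp add: ks_block_def one)
    also have "(\<Sum>i\<in>I. \<Sum>j\<in>I. cnj (v (0, i)) * T (mmult I X X) i j * v (0, j)) = T (mmult I X X) m m"
      by (simp only: v_def fst_conv snd_conv if_True simp_thms cpick pick' pick mult.assoc sum_distrib_left[symmetric])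
    also have "(\<Sum>i\<in>I. \<Sum>j\<in>I. cnj (v (0, i)) * T X i j * v (1, j)) = - (\<Sum>j\<in>I. cnj (q j) * q j)"
      unfolding v_def by (simp only: fst_conv snd_conv simp_thms if_True zero_neq_one one_neq_zero if_False cpick pick' pick mult.assoc sum_distrib_left[symmetric])
         (simp add: sum_negf q_def sym)
    also have "(\<Sum>i\<in>I. \<Sum>j\<in>I. cnj (v (1, i)) * T X i j * v (0, j)) = - (\<Sum>j\<in>I. cnj (q j) * q j)"
      unfolding v_def by (simp only: fst_conv snd_conv simp_thms if_True zero_neq_one one_neq_zero if_False cpick pick' pick)
         (simp add: sum_negf q_def)
    also have "(\<Sum>i\<in>I. \<Sum>j\<in>I. cnj (v (1, i)) * mone I i j * v (1, j)) = (\<Sum>j\<in>I. cnj (q j) * q j)"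
    proof (rule sum.cong[OF refl])
      fix i assume i: "i \<in> I"
      have "(\<Sum>j\<in>I. cnj (v (1, i)) * mone I i j * v (1, j)) = (\<Sum>j\<in>I. if j = i then cnj (q i) * q i else 0)"
        by (rule sum.cong) (auto simp: mone_def v_def)
      then show "(\<Sum>j\<in>I. cnj (v (1, i)) * mone I i j * v (1, j)) = cnj (q i) * q i"
        using i fin by simp
    qed
    finally have "qform ({0..<2} \<times> I) ?Z v = T (mmult I X X) m m - of_real (\<Sum>j\<in>I. (cmod (q j))\<^sup>2)"
      unfolding cnj_mult_self_sum by simp
    moreover have "0 \<le> Re (qform ({0..<2} \<times> I) ?Z v)" using psd by (simp add: psd_def)
    ultimately show ?thesis by (simp add: q_def del: of_real_sum)
  qed
  have "(hs_norm I (T X))\<^sup>2 = (\<Sum>j\<in>I. \<Sum>m\<in>I. (cmod (T X j m))\<^sup>2)"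
    unfolding hs_norm_def by (intro real_sqrt_pow2 sum_nonneg) auto
  also have "\<dots> = (\<Sum>m\<in>I. \<Sum>j\<in>I. (cmod (T X j m))\<^sup>2)"
    by (rule sum.swap)
  also have "\<dots> \<le> (\<Sum>m\<in>I. Re (T (mmult I X X) m m))"
    by (rule sum_mono) (rule diag)
  finally show "(hs_norm I (T X))\<^sup>2 \<le> Re (mtrace I (T (mmult I X X)))"
    by (simp add: mtrace_def)
qed

section \<open>Properties of the generator inherited from the semigroup\<close>

lemma liouvillian_traceless:
  assumes fin: "finite I" and L: "liouvillian I L" and X: "X \<in> mats I"
  shows "mtrace I (L X) = 0"
proof -
  have s: "sop_on I L" using L by (simp add: liouvillian_def)
  have "((\<lambda>t. \<Sum>i\<in>I. (sop_exp I t L X i i - X i i) / of_real t) \<longlongrightarrow> (\<Sum>i\<in>I. L X i i)) (at_right 0)"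
    by (intro tendsto_sum sop_exp_right_derivative[OF s fin X])
  moreover have "\<forall>\<^sub>F t in at_right 0. (\<Sum>i\<in>I. (sop_exp I t L X i i - X i i) / of_real t) = 0"
    using eventually_at_right_less[of "0::real"]
  proof eventually_elim
    case (elim t)
    then have "mtrace I (sop_exp I t L X) = mtrace I X"
      using L X by (simp add: liouvillian_def trace_preserving_def)
    then show ?case
      by (simp add: sum_divide_distrib[symmetric] sum_subtractf mtrace_def)
  qed
  ultimately have "((\<lambda>t. 0) \<longlongrightarrow> (\<Sum>i\<in>I. L X i i)) (at_right (0::real))"
    by (rule Lim_transform_eventually)
  then show ?thesis by (simp add: mtrace_def tendsto_const_iff)
qed

lemma liouvillian_hermitian:
  assumes fin: "finite I" and L: "liouvillian I L" and X: "hermitian I X"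
  shows "hermitian I (L X)"
proof -
  have s: "sop_on I L" using L by (simp add: liouvillian_def)
  have Xm: "X \<in> mats I" using X by (simp add: hermitian_def)
  have "cnj (L X j i) = L X i j" for i j
  proof (rule tendsto_unique[of "at_right (0::real)"])
    show "((\<lambda>t. cnj ((sop_exp I t L X j i - X j i) / of_real t)) \<longlongrightarrow> cnj (L X j i)) (at_right 0)"
      by (intro tendsto_cnj sop_exp_right_derivative[OF s fin Xm])
    have *: "\<forall>\<^sub>F t in at_right 0. (sop_exp I t L X i j - X i j) / of_real t
       = cnj ((sop_exp I t L X j i - X j i) / of_real t)"
      using eventually_at_right_less[of "0::real"]
    proof eventually_elim
      case (elim t)
      then have "hermitian I (sop_exp I t L X)"
        using L completely_positive_hermitian[OF fin _ X] by (simp add: liouvillian_def)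
      then show ?case using hermitian_sym[OF X] by (simp add: hermitian_sym)
    qed
    show "((\<lambda>t. cnj ((sop_exp I t L X j i - X j i) / of_real t)) \<longlongrightarrow> L X i j) (at_right 0)"
      by (rule Lim_transform_eventually[OF sop_exp_right_derivative[OF s fin Xm] *])
  qed simp
  then show ?thesis using sop_on_mats[OF s Xm] by (auto simp: hermitian_def madj_def)
qed

text \<open>All terms of the series beyond the zeroth vanish. This is the unitality that
  Kadison--Schwarz asks for.\<close>

lemma sop_exp_mone:
  assumes L: "sop_on I L" and ds: "doubly_stochastic I L"
  shows "sop_exp I t L (mone I) = mone I"
proof (intro ext)
  fix i j
  have z: "L mzero = mzero"
    using sop_on_scale[OF L, of mzero 0] by (simp add: mzero_def mats_def)
  have "(L ^^ Suc k) (mone I) = mzero" for k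
    by (induction k) (use ds z in \<open>auto simp: doubly_stochastic_def\<close>)
  then have "(L ^^ k) (mone I) i j = 0" if "k \<noteq> 0" for k
    using that by (cases k) (auto simp: mzero_def)
  then have "sop_exp I t L (mone I) i j = (\<Sum>k\<in>{0}. complex_of_real (t ^ k / fact k) * (L ^^ k) (mone I) i j)"
    unfolding sop_exp_def by (intro suminf_finite) auto
  then show "sop_exp I t L (mone I) i j = mone I i j" by simp
qed

text \<open>Kadison--Schwarz and trace preservation bound the squared norm of T_t X by that of X.
  With T_t X = X + t q_t this reads 2 t Re <X, q_t> + t^2 |q_t|^2 \<le> 0; dividing by t and letting
  t tend to 0 gives the claim.\<close>

lemma liouvillian_dissipative:
  assumes fin: "finite I" and L: "liouvillian I L" and ds: "doubly_stochastic I L"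
    and X: "hermitian I X"
  shows "Re (hs_ip I X (L X)) \<le> 0"
proof -
  have s: "sop_on I L" using L by (simp add: liouvillian_def)
  have Xm: "X \<in> mats I" using X by (simp add: hermitian_def)
  define q where "q = (\<lambda>t i j. (sop_exp I t L X i j - X i j) / of_real t)"
  have lim: "((\<lambda>t. Re (hs_ip I X (q t))) \<longlongrightarrow> Re (hs_ip I X (L X))) (at_right 0)"
    unfolding hs_ip_def q_def
    by (intro tendsto_Re tendsto_sum tendsto_mult tendsto_const sop_exp_right_derivative[OF s fin Xm])
  have "\<forall>\<^sub>F t in at_right 0. Re (hs_ip I X (q t)) \<le> 0"
    using eventually_at_right_less[of "0::real"]
  proof eventually_elim
    case (elim t)
    then have cp: "completely_positive I (sop_exp I t L)" and tp: "trace_preserving I (sop_exp I t L)"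
      using L by (simp_all add: liouvillian_def)
    have e: "sop_exp I t L X = (\<lambda>i j. 1 * X i j + of_real t * q t i j)"
      using elim by (intro ext) (simp add: q_def)
    have "(hs_norm I (sop_exp I t L X))\<^sup>2 \<le> Re (mtrace I (mmult I X X))"
      using kadison_schwarz_trace[OF fin cp X sop_exp_mone[OF s ds]] tp mmult_mats[OF Xm Xm]
      by (simp add: trace_preserving_def)
    also have "\<dots> = Re (hs_ip I X X)" by (simp add: mtrace_mmult_hermitian[OF X])
    finally have "Re (hs_ip I (sop_exp I t L X) (sop_exp I t L X)) \<le> Re (hs_ip I X X)"
      by (simp add: hs_ip_self[of _ "sop_exp I t L X"] del: of_real_power)
    moreover have "hs_ip I (sop_exp I t L X) (sop_exp I t L X)
       = hs_ip I X X + t * (hs_ip I X (q t) + cnj (hs_ip I X (q t))) + of_real (t\<^sup>2 * (hs_norm I (q t))\<^sup>2)"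
      unfolding e hs_ip_lin_left hs_ip_lin_right
      by (simp add: cnj_hs_ip hs_ip_self[of I "q t"] algebra_simps power2_eq_square)
    ultimately have "t * (2 * Re (hs_ip I X (q t))) \<le> - (t\<^sup>2 * (hs_norm I (q t))\<^sup>2)"
      by simp
    also have "\<dots> \<le> 0" by simp
    finally show ?case using elim by (simp add: mult_le_0_iff)
  qed
  then show ?thesis
    by (intro tendsto_upperbound[OF lim]) auto
qed

subsection \<open>Comparison with the depolarizing Liouvillian\<close>

lemma hs_ip_mone: "finite I \<Longrightarrow> hs_ip I (mone I) Y = mtrace I Y"
proof -
  assume fin: "finite I"
  have "(\<Sum>j\<in>I. cnj (mone I i j) * Y i j) = Y i i" if i: "i \<in> I" for i
  proof -
    have "(\<Sum>j\<in>I. cnj (mone I i j) * Y i j) = (\<Sum>j\<in>I. if j = i then Y i i else 0)"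
      by (rule sum.cong) (use i in \<open>auto simp: mone_def\<close>)
    then show ?thesis using i fin by simp
  qed
  then show ?thesis by (simp add: hs_ip_def mtrace_def)
qed

text \<open>The infima in \<open>alpha2\<close> and \<open>spectral_gap\<close> thus range over
  nonempty sets.\<close>

lemma exists_nonscalar_posdef:
  assumes fin: "finite I" and card: "2 \<le> card I"
  shows "\<exists>X. posdef I X \<and> \<not> (\<exists>c. X = mscale c (mone I))"
proof -
  obtain a b where ab: "a \<in> I" "b \<in> I" "a \<noteq> b"
    using card card_le_Suc0_iff_eq[OF fin] by force
  \<comment> \<open>The witness is diag(2, 1, ..., 1), with the 2 at \<open>a\<close>.\<close>
  define w :: "'a \<Rightarrow> real" where "w = (\<lambda>i. if i = a then 2 else 1)"
  define X :: "'a cmat" where "X = (\<lambda>i j. if i = j \<and> i \<in> I then of_real (w i) else 0)"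
  have "hermitian I X"
    by (auto simp: hermitian_def mats_def madj_def X_def intro!: ext)
  moreover have "Re (qform I X v) > 0" if v: "\<exists>i\<in>I. v i \<noteq> 0" for v
  proof -
    have "qform I X v = (\<Sum>i\<in>I. of_real (w i) * (cnj (v i) * v i))"
      unfolding qform_def
    proof (rule sum.cong[OF refl])
      fix i assume i: "i \<in> I"
      have "(\<Sum>j\<in>I. cnj (v i) * X i j * v j) = (\<Sum>j\<in>I. if j = i then of_real (w i) * (cnj (v i) * v i) else 0)"
        by (rule sum.cong) (use i in \<open>auto simp: X_def\<close>)
      then show "(\<Sum>j\<in>I. cnj (v i) * X i j * v j) = of_real (w i) * (cnj (v i) * v i)"
        using i fin by simp
    qed
    also have "\<dots> = of_real (\<Sum>i\<in>I. w i * (cmod (v i))\<^sup>2)"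
      by (simp add: mult.commute[of "cnj _"] flip: complex_norm_square)
    finally have "Re (qform I X v) = (\<Sum>i\<in>I. w i * (cmod (v i))\<^sup>2)"
      by (simp only: Re_complex_of_real)
    also have "\<dots> > 0"
    proof -
      obtain i where i: "i \<in> I" "v i \<noteq> 0" using v by blast
      show ?thesis
        by (rule sum_pos2[OF fin i(1)]) (use i in \<open>auto simp: w_def\<close>)
    qed
    finally show ?thesis .
  qed
  moreover have "X \<noteq> mscale c (mone I)" for c
  proof
    assume "X = mscale c (mone I)"
    then have "X a a = mscale c (mone I) a a" "X b b = mscale c (mone I) b b" by simp_all
    then show False using ab by (simp add: X_def w_def mscale_def mone_def)
  qed
  ultimately show ?thesis unfolding posdef_def by blast
qed

section \<open>Adjoint, symmetrization and operator norm\<close>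

lemma hs_ip_sop_adj:
  assumes L: "sop_on I L" and fin: "finite I" and Y: "Y \<in> mats I"
  shows "hs_ip I Y (sop_adj I L Y) = hs_ip I (L Y) Y"
proof -
  let ?f = "\<lambda>p q r s. cnj (Y p q) * (cnj (L (munit p q) r s) * Y r s)"
  have "hs_ip I Y (sop_adj I L Y) = (\<Sum>p\<in>I. \<Sum>q\<in>I. \<Sum>r\<in>I. \<Sum>s\<in>I. ?f p q r s)"
    by (simp add: hs_ip_def sop_adj_def sum_distrib_left)
  also have "\<dots> = (\<Sum>p\<in>I. \<Sum>r\<in>I. \<Sum>q\<in>I. \<Sum>s\<in>I. ?f p q r s)"
    by (rule sum.cong[OF refl]) (rule sum.swap)
  also have "\<dots> = (\<Sum>r\<in>I. \<Sum>p\<in>I. \<Sum>q\<in>I. \<Sum>s\<in>I. ?f p q r s)"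
    by (rule sum.swap)
  also have "\<dots> = (\<Sum>r\<in>I. \<Sum>p\<in>I. \<Sum>s\<in>I. \<Sum>q\<in>I. ?f p q r s)"
    by (rule sum.cong[OF refl], rule sum.cong[OF refl], rule sum.swap)
  also have "\<dots> = (\<Sum>r\<in>I. \<Sum>s\<in>I. \<Sum>p\<in>I. \<Sum>q\<in>I. ?f p q r s)"
    by (rule sum.cong[OF refl]) (rule sum.swap)
  also have "\<dots> = hs_ip I (L Y) Y"
    by (simp add: hs_ip_def sop_on_expand[OF L fin Y] sum_distrib_right mult.assoc)
  finally show ?thesis .
qed

text \<open>The adjoint contributes the complex conjugate, so symmetrizing leaves the real part,
  which is what the Dirichlet form sees.\<close>

lemma hs_ip_sop_sym:
  assumes "sop_on I L" "finite I" "Y \<in> mats I"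
  shows "hs_ip I Y (sop_sym I L Y) = of_real (Re (hs_ip I Y (L Y)))"
proof -
  have "sop_sym I L Y = (\<lambda>i j. (1/2) * L Y i j + (1/2) * sop_adj I L Y i j)"
    by (simp add: sop_sym_def add_divide_distrib)
  then have "hs_ip I Y (sop_sym I L Y) = (hs_ip I Y (L Y) + cnj (hs_ip I Y (L Y))) / 2"
    using hs_ip_sop_adj[OF assms] by (simp only: hs_ip_lin_right cnj_hs_ip) simp
  then show ?thesis by (simp add: complex_add_cnj)
qed

text \<open>A \<open>Sup\<close> of reals dominates its members only when the set is bounded above;
  entrywise bounds are enough for that.\<close>

lemma op_norm_sop_sym_bdd:
  assumes L: "sop_on I L" and fin: "finite I"
  shows "bdd_above {hs_norm I (sop_sym I L X) | X. X \<in> mats I \<and> hs_norm I X = 1}"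
proof -
  obtain M where M: "M \<ge> 0"
    "\<And>X c i j. X \<in> mats I \<Longrightarrow> (\<And>r s. cmod (X r s) \<le> c) \<Longrightarrow> cmod (L X i j) \<le> M * c"
    using sop_on_bounded[OF L fin] by blast
  \<comment> \<open>Bounds the entries of the adjoint, each a double sum over \<open>I\<close> of
    terms of modulus at most \<open>M\<close>.\<close>
  define N where "N = (\<Sum>r\<in>I. \<Sum>s\<in>I. M)"
  have N: "N \<ge> 0" unfolding N_def using M by (intro sum_nonneg) auto
  have bound: "hs_norm I (sop_sym I L X) \<le> (\<Sum>i\<in>I. \<Sum>j\<in>I. M + N)"
    if X: "X \<in> mats I" and n1: "hs_norm I X = 1" for X
  proof -
    have X1: "cmod (X r s) \<le> 1" for r s
    proof (cases "r \<in> I \<and> s \<in> I")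
      case True
      then show ?thesis using hs_norm_entry[OF fin, of r s X] n1 by simp
    next
      case False
      then have "X r s = 0" using X by (auto simp: mats_def)
      then show ?thesis by simp
    qed
    have "cmod (sop_sym I L X i j) \<le> M + N" if i: "i \<in> I" "j \<in> I" for i j
    proof -
      have 1: "cmod (L X i j) \<le> M" using M(2)[OF X X1] by simp
      have E: "cmod (L (munit i j) r s) \<le> M" for r s
        using M(2)[OF munit_mats[OF i], of 1] by (simp add: munit_def)
      have adj: "sop_adj I L X i j = (\<Sum>r\<in>I. \<Sum>s\<in>I. cnj (L (munit i j) r s) * X r s)"
        using i by (simp add: sop_adj_def)
      have "cmod (cnj (L (munit i j) r s) * X r s) \<le> M" for r s
        using mult_mono[OF E X1 M(1), of r s r s] by (simp add: norm_mult)
      then have "cmod (sop_adj I L X i j) \<le> N"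
        unfolding N_def adj by (intro sum_norm_le)
      then have "cmod (L X i j + sop_adj I L X i j) \<le> M + N"
        using 1 norm_triangle_ineq[of "L X i j" "sop_adj I L X i j"] by linarith
      moreover have "cmod (sop_sym I L X i j) = cmod (L X i j + sop_adj I L X i j) / 2"
        by (simp add: sop_sym_def norm_divide)
      ultimately show ?thesis using M(1) N by simp
    qed
    then show ?thesis
      by (intro order.trans[OF hs_norm_le_sum] sum_mono)
  qed
  show ?thesis
    by (rule bdd_aboveI[of _ "\<Sum>i\<in>I. \<Sum>j\<in>I. M + N"]) (use bound in auto)
qed

text \<open>The \<open>Sup\<close> lies above at least one norm, since the matrix unit
  \<open>munit a a\<close> has norm 1.\<close>

lemma op_norm_sop_sym_nonneg:
  assumes L: "sop_on I L" and fin: "finite I" and ne: "I \<noteq> {}"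
  shows "0 \<le> op_norm I (sop_sym I L)"
proof -
  obtain a where a: "a \<in> I" using ne by blast
  have "hs_ip I (munit a a) (munit a a) = 1"
  proof -
    have "hs_ip I (munit a a) (munit a a) = (\<Sum>i\<in>I. \<Sum>j\<in>I. if j = a then (if i = a then 1 else 0) else 0)"
      unfolding hs_ip_def by (intro sum.cong refl) (auto simp: munit_def)
    then show ?thesis using a fin by simp
  qed
  then have "complex_of_real ((hs_norm I (munit a a))\<^sup>2) = of_real 1"
    by (simp only: hs_ip_self) simp
  then have "(hs_norm I (munit a a))\<^sup>2 = 1" by (simp only: of_real_eq_iff)
  then have "hs_norm I (munit a a) = 1" using hs_norm_nonneg[of I "munit a a"]
    by (simp add: power2_eq_1_iff)
  then have "hs_norm I (sop_sym I L (munit a a)) \<le> op_norm I (sop_sym I L)"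
    unfolding op_norm_def using munit_mats[OF a a]
    by (intro cSup_upper[OF _ op_norm_sop_sym_bdd[OF L fin]]) auto
  then show ?thesis using hs_norm_nonneg order.trans by blast
qed

lemma sop_sym_scale:
  assumes L: "sop_on I L" and X: "X \<in> mats I"
  shows "sop_sym I L (\<lambda>i j. c * X i j) = (\<lambda>i j. c * sop_sym I L X i j)"
  by (intro ext) (auto simp: sop_sym_def sop_on_scale[OF L X] sop_adj_def sum_distrib_left algebra_simps)

lemma hs_norm_sop_sym_le:
  assumes L: "sop_on I L" and fin: "finite I" and ne: "I \<noteq> {}" and Y: "Y \<in> mats I"
  shows "hs_norm I (sop_sym I L Y) \<le> op_norm I (sop_sym I L) * hs_norm I Y"
proof (cases "hs_norm I Y = 0")
  case True
  have "Y = (\<lambda>i j. 0 * Y i j)"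
  proof (intro ext)
    fix i j show "Y i j = 0 * Y i j"
      using hs_norm_entry[OF fin, of i j Y] True Y by (cases "i \<in> I \<and> j \<in> I") (auto simp: mats_def)
  qed
  then have "sop_sym I L Y = (\<lambda>i j. 0 * sop_sym I L Y i j)"
    using sop_sym_scale[OF L Y, of 0] by simp
  then have "hs_norm I (sop_sym I L Y) = 0"
    using hs_norm_scale[of I 0 "sop_sym I L Y"] by simp
  then show ?thesis using True by simp
next
  case False
  then have pos: "hs_norm I Y > 0" using hs_norm_nonneg[of I Y] by simp
  define c where "c = complex_of_real (1 / hs_norm I Y)"
  have c: "cmod c = 1 / hs_norm I Y" using pos unfolding c_def norm_of_real by simp
  have m: "(\<lambda>i j. c * Y i j) \<in> mats I" using Y by (auto simp: mats_def)
  have "hs_norm I (\<lambda>i j. c * Y i j) = 1" unfolding hs_norm_scale c using pos by simp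
  then have "hs_norm I (sop_sym I L (\<lambda>i j. c * Y i j)) \<le> op_norm I (sop_sym I L)"
    unfolding op_norm_def using m
    by (intro cSup_upper[OF _ op_norm_sop_sym_bdd[OF L fin]]) auto
  then show ?thesis
    unfolding sop_sym_scale[OF L Y] hs_norm_scale c using pos by (simp add: field_simps)
qed

section \<open>Centring, variance and spectral gap\<close>

text \<open>The orthogonal projection onto the traceless matrices, which is \<open>ldep\<close> up
  to sign. The body copies the local \<open>Y\<close> of \<open>variance\<close> so that it can be
  folded.\<close>

definition centre :: "'i set \<Rightarrow> 'i cmat \<Rightarrow> 'i cmat" where
  "centre I X = madd X (mscale (- mtrace I X / of_nat (card I)) (mone I))"

lemma centre_alt: "centre I X = (\<lambda>i j. 1 * X i j + (- mtrace I X / of_nat (card I)) * mone I i j)"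
  by (simp add: centre_def madd_def mscale_def)

lemma centre_mats: "X \<in> mats I \<Longrightarrow> centre I X \<in> mats I"
  unfolding centre_alt by (intro mats_lin mone_mats)

lemma mtrace_mone: "mtrace I (mone I) = of_nat (card I)"
  by (simp add: mtrace_def mone_def)

lemma hs_ip_mone_right:
  assumes "finite I"
  shows "hs_ip I Y (mone I) = cnj (mtrace I Y)"
  using cnj_hs_ip[of I "mone I" Y] hs_ip_mone[OF assms, of Y] by simp

lemma hs_norm_centre:
  assumes fin: "finite I" and ne: "I \<noteq> {}"
  shows "(hs_norm I (centre I Y))\<^sup>2 = - Re (hs_ip I Y (ldep I Y))"
proof -
  define D :: complex where "D = of_nat (card I)"
  have D: "D \<noteq> 0" "cnj D = D" using fin ne by (simp_all add: D_def)
  have l: "ldep I Y = (\<lambda>i j. (mtrace I Y / D) * mone I i j + (-1) * Y i j)"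
    by (simp add: ldep_def D_def)
  have "hs_ip I (centre I Y) (centre I Y) = - hs_ip I Y (ldep I Y)"
    unfolding centre_alt l D_def[symmetric] hs_ip_lin_left hs_ip_lin_right
      hs_ip_mone[OF fin] hs_ip_mone_right[OF fin] mtrace_mone
    unfolding D_def[symmetric]
    using D by (simp add: field_simps)
  then have "complex_of_real ((hs_norm I (centre I Y))\<^sup>2) = - hs_ip I Y (ldep I Y)"
    by (simp only: hs_ip_self)
  then have "Re (complex_of_real ((hs_norm I (centre I Y))\<^sup>2)) = Re (- hs_ip I Y (ldep I Y))"
    by (rule arg_cong)
  then show ?thesis by (simp only: Re_complex_of_real uminus_complex.sel)
qed

text \<open>\<open>L\<close> kills the identity, and its values are traceless, hence orthogonal to
  the identity; so the scalar part drops out of both arguments.\<close>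

lemma hs_ip_centre:
  assumes fin: "finite I" and L: "liouvillian I L" and ds: "doubly_stochastic I L" and Y: "Y \<in> mats I"
  shows "hs_ip I (centre I Y) (L (centre I Y)) = hs_ip I Y (L Y)"
proof -
  have s: "sop_on I L" using L by (simp add: liouvillian_def)
  have z: "L (mone I) i j = 0" for i j using ds by (simp add: doubly_stochastic_def mzero_def)
  have "L (centre I Y) = L Y"
    unfolding centre_alt sop_on_lin[OF s Y mone_mats] z by simp
  then show ?thesis
    using liouvillian_traceless[OF fin L Y]
    by (simp only: hs_ip_lin_left centre_alt hs_ip_mone[OF fin]) simp
qed

lemma dissipation_le_op_norm:
  assumes fin: "finite I" and ne: "I \<noteq> {}" and L: "liouvillian I L" and ds: "doubly_stochastic I L"
    and Y: "Y \<in> mats I"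
  shows "- Re (hs_ip I Y (L Y)) \<le> op_norm I (sop_sym I L) * - Re (hs_ip I Y (ldep I Y))"
proof -
  have s: "sop_on I L" using L by (simp add: liouvillian_def)
  let ?Z = "centre I Y"
  note Z = centre_mats[OF Y]
  have "- Re (hs_ip I Y (L Y)) \<le> cmod (hs_ip I ?Z (sop_sym I L ?Z))"
    using hs_ip_sop_sym[OF s fin Z] hs_ip_centre[OF fin L ds Y] by simp
  also have "\<dots> \<le> hs_norm I ?Z * hs_norm I (sop_sym I L ?Z)" by (rule hs_ip_cauchy_schwarz)
  also have "\<dots> \<le> hs_norm I ?Z * (op_norm I (sop_sym I L) * hs_norm I ?Z)"
    by (intro mult_left_mono hs_norm_sop_sym_le[OF s fin ne Z] hs_norm_nonneg)
  also have "\<dots> = op_norm I (sop_sym I L) * (hs_norm I ?Z)\<^sup>2"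
    by (simp add: power2_eq_square)
  finally show ?thesis unfolding hs_norm_centre[OF fin ne] .
qed

lemma variance_eq:
  assumes fin: "finite I" and ne: "I \<noteq> {}" and X: "hermitian I X"
  shows "variance I X = - Re (hs_ip I X (ldep I X)) / real (card I)"
proof -
  have "cnj (mtrace I X) = mtrace I X" by (simp add: mtrace_def hermitian_sym[OF X])
  then have "madj (centre I X) = centre I X"
    by (simp add: madj_def centre_alt hermitian_sym[OF X] hermitian_sym[OF hermitian_mone])
  then have h: "hermitian I (centre I X)"
    using X centre_mats[of X I] by (simp add: hermitian_def)
  have "mtrace I (mmult I (centre I X) (centre I X)) = of_real ((hs_norm I (centre I X))\<^sup>2)"
    by (simp only: mtrace_mmult_hermitian[OF h] hs_ip_self)
  then show ?thesis
    unfolding variance_def Let_def centre_def[symmetric] hs_norm_centre[OF fin ne, symmetric] by simp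
qed

lemma dirichlet_eq:
  "hermitian I X \<Longrightarrow> dirichlet I L X = - Re (hs_ip I X (L X)) / real (card I)"
  by (simp add: dirichlet_def mtrace_mmult_hermitian)

lemma spectral_gap_ratio_nonneg:
  assumes fin: "finite I" and ne: "I \<noteq> {}" and L: "liouvillian I L" and ds: "doubly_stochastic I L"
    and X: "hermitian I X"
  shows "0 \<le> dirichlet I L X / variance I X"
  unfolding dirichlet_eq[OF X] variance_eq[OF fin ne X] hs_norm_centre[OF fin ne, symmetric]
  using liouvillian_dissipative[OF fin L ds X] by (intro divide_nonneg_nonneg) auto

lemma spectral_gap_nonneg:
  assumes fin: "finite I" and card: "2 \<le> card I" and L: "liouvillian I L" and ds: "doubly_stochastic I L"
  shows "0 \<le> spectral_gap I L"
proof -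
  have ne: "I \<noteq> {}" using card by auto
  show ?thesis unfolding spectral_gap_def
    by (rule cInf_greatest)
      (use exists_nonscalar_posdef[OF fin card] spectral_gap_ratio_nonneg[OF fin ne L ds] in
        \<open>auto simp: posdef_def\<close>)
qed

text \<open>The quotient bound is multiplied out where the variance is positive. Scalar matrices,
  excluded from the infimum, have zero centred part; there the claim is dissipativity.\<close>

lemma spectral_gap_le_hermitian:
  assumes fin: "finite I" and ne: "I \<noteq> {}" and L: "liouvillian I L" and ds: "doubly_stochastic I L"
    and X: "hermitian I X"
  shows "spectral_gap I L * - Re (hs_ip I X (ldep I X)) \<le> - Re (hs_ip I X (L X))"
proof (cases "hs_norm I (centre I X) = 0")
  case True
  then show ?thesis
    using liouvillian_dissipative[OF fin L ds X] hs_norm_centre[OF fin ne, of X] by simp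
next
  case False
  define D where "D = real (card I)"
  have D: "D > 0" using fin ne by (simp add: D_def card_gt_0_iff)
  have ns: "X \<noteq> mscale c (mone I)" for c
  proof
    assume X': "X = mscale c (mone I)"
    have "centre I X = (\<lambda>i j. 0 * X i j)"
      using fin ne by (intro ext) (simp add: X' centre_def madd_def mscale_def mtrace_def mone_def)
    then show False using False hs_norm_scale[of I 0 X] by simp
  qed
  have "spectral_gap I L \<le> dirichlet I L X / variance I X"
    unfolding spectral_gap_def
  proof (rule cInf_lower)
    show "bdd_below {dirichlet I L X / variance I X |X. hermitian I X \<and> \<not> (\<exists>c. X = mscale c (mone I))}"
      by (rule bdd_belowI[of _ 0]) (use spectral_gap_ratio_nonneg[OF fin ne L ds] in auto)
  qed (use X ns in blast)
  also have "\<dots> = - Re (hs_ip I X (L X)) / - Re (hs_ip I X (ldep I X))"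
    unfolding dirichlet_eq[OF X] variance_eq[OF fin ne X] D_def[symmetric] using D by simp
  finally have "spectral_gap I L \<le> - Re (hs_ip I X (L X)) / - Re (hs_ip I X (ldep I X))" .
  moreover have "0 < - Re (hs_ip I X (ldep I X))"
    using False unfolding hs_norm_centre[OF fin ne, of X, symmetric] by simp
  ultimately show ?thesis by (simp only: pos_le_divide_eq)
qed

text \<open>With \<open>Y = H + i K\<close> for Hermitian \<open>H\<close> and \<open>K\<close>, the cross terms are purely imaginary.\<close>
lemma hs_ip_cartesian:
  assumes L: "sop_on I L" and LH: "\<And>X. hermitian I X \<Longrightarrow> hermitian I (L X)"
    and H: "hermitian I H" and K: "hermitian I K"
  shows "Re (hs_ip I (\<lambda>i j. 1 * H i j + \<i> * K i j) (L (\<lambda>i j. 1 * H i j + \<i> * K i j)))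
    = Re (hs_ip I H (L H)) + Re (hs_ip I K (L K))"
proof -
  have m: "H \<in> mats I" "K \<in> mats I" using H K by (simp_all add: hermitian_def)
  show ?thesis
    unfolding sop_on_lin[OF L m] hs_ip_lin_left hs_ip_lin_right
    using hs_ip_hermitian_real[OF H LH[OF K]] hs_ip_hermitian_real[OF K LH[OF H]]
    by simp
qed

lemma ldep_sop_on:
  assumes "finite I"
  shows "sop_on I (ldep I)"
proof -
  have "mtrace I (madd (mscale a X) (mscale b Y)) = a * mtrace I X + b * mtrace I Y" for a b X Y
    by (simp add: mtrace_def madd_def mscale_def sum.distrib sum_distrib_left)
  moreover have "ldep I X \<in> mats I" if "X \<in> mats I" for X
    using that mone_mats[of I] by (auto simp: ldep_def mats_def)
  ultimately show ?thesis
    unfolding sop_on_def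
    by (auto simp: ldep_def madd_def mscale_def add_divide_distrib algebra_simps intro!: ext)
qed

lemma ldep_hermitian:
  assumes "finite I" "hermitian I X"
  shows "hermitian I (ldep I X)"
proof -
  have "cnj (mtrace I X) = mtrace I X" by (simp add: mtrace_def hermitian_sym[OF assms(2)])
  then have "madj (ldep I X) = ldep I X"
    by (intro ext) (simp add: madj_def ldep_def hermitian_sym[OF assms(2)] hermitian_sym[OF hermitian_mone])
  then show ?thesis
    using assms sop_on_mats[OF ldep_sop_on[OF assms(1)], of X] by (simp add: hermitian_def)
qed

text \<open>Both quadratic forms split over the Hermitian parts \<open>H\<close> and
  \<open>K\<close>, so the Hermitian case is applied to each and added.\<close>

lemma spectral_gap_le_dissipation:
  assumes fin: "finite I" and ne: "I \<noteq> {}" and L: "liouvillian I L" and ds: "doubly_stochastic I L"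
    and Y: "Y \<in> mats I"
  shows "spectral_gap I L * - Re (hs_ip I Y (ldep I Y)) \<le> - Re (hs_ip I Y (L Y))"
proof -
  have s: "sop_on I L" using L by (simp add: liouvillian_def)
  define H where "H = (\<lambda>i j. (Y i j + cnj (Y j i)) / 2)"
  define K where "K = (\<lambda>i j. (Y i j - cnj (Y j i)) / (2 * \<i>))"
  have H: "hermitian I H" and K: "hermitian I K"
    using Y by (auto simp: hermitian_def mats_def madj_def H_def K_def divide_simps complex_eq_iff intro!: ext)
  have Yeq: "Y = (\<lambda>i j. 1 * H i j + \<i> * K i j)"
    by (intro ext) (simp add: H_def K_def field_simps)
  have 1: "Re (hs_ip I Y (L Y)) = Re (hs_ip I H (L H)) + Re (hs_ip I K (L K))"
    unfolding Yeq by (rule hs_ip_cartesian[OF s liouvillian_hermitian[OF fin L] H K])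
  have 2: "Re (hs_ip I Y (ldep I Y)) = Re (hs_ip I H (ldep I H)) + Re (hs_ip I K (ldep I K))"
    unfolding Yeq by (rule hs_ip_cartesian[OF ldep_sop_on[OF fin] ldep_hermitian[OF fin] H K])
  show ?thesis
    unfolding 1 2
    using spectral_gap_le_hermitian[OF fin ne L ds H] spectral_gap_le_hermitian[OF fin ne L ds K]
    by (simp add: algebra_simps)
qed

subsection \<open>Tensor products\<close>

lemma finite_tens: "finite (tens d n)"
  by (simp add: tens_def finite_PiE)

lemma card_tens: "card (tens d n) = d ^ n"
  by (simp add: tens_def card_PiE)

lemma tens_upd: "a \<in> tens d n \<Longrightarrow> k < n \<Longrightarrow> p < d \<Longrightarrow> a(k := p) \<in> tens d n"
  by (auto simp: tens_def PiE_def extensional_def)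

lemma tens_lt: "a \<in> tens d n \<Longrightarrow> k < n \<Longrightarrow> a k < d"
  by (auto simp: tens_def)

text \<open>\<open>(a, p) \<mapsto> (a(k := p), a k)\<close> is an involution; this replaces splitting off the \<open>k\<close>-th index.\<close>
lemma sum_tens_average:
  fixes G :: "(nat \<Rightarrow> nat) \<Rightarrow> complex"
  assumes k: "k < n"
  shows "(\<Sum>a\<in>tens d n. \<Sum>p<d. G (a(k := p))) = of_nat d * (\<Sum>a\<in>tens d n. G a)"
proof -
  have "(\<Sum>a\<in>tens d n. \<Sum>p<d. G (a(k := p))) = (\<Sum>(a, p)\<in>tens d n \<times> {..<d}. G (a(k := p)))"
    by (rule sum.cartesian_product)
  also have "\<dots> = (\<Sum>(a, p)\<in>tens d n \<times> {..<d}. G a)"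
    by (rule sum.reindex_bij_witness[where i = "\<lambda>(a, p). (a(k := p), a k)" and j = "\<lambda>(a, p). (a(k := p), a k)"])
       (auto simp: k tens_upd tens_lt)
  also have "\<dots> = (\<Sum>a\<in>tens d n. \<Sum>p<d. G a)"
    by (rule sum.cartesian_product[symmetric])
  finally show ?thesis by (simp add: sum_distrib_left)
qed

text \<open>The block of \<open>X\<close> at site \<open>k\<close> with the other indices frozen at
  \<open>a\<close> and \<open>b\<close>. The values \<open>a k\<close> and \<open>b k\<close> are
  overwritten, so d^2 pairs of tuples give the same slice; entries outside the range are 0 so that
  it lies in \<open>mats\<close>.\<close>

definition slice :: "nat \<Rightarrow> nat \<Rightarrow> (nat \<Rightarrow> nat) cmat \<Rightarrow> (nat \<Rightarrow> nat) \<Rightarrow> (nat \<Rightarrow> nat) \<Rightarrow> nat cmat" where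
  "slice d k X a b = (\<lambda>p q. if p < d \<and> q < d then X (a(k := p)) (b(k := q)) else 0)"

lemma slice_mats: "slice d k X a b \<in> mats {..<d}"
  by (auto simp: slice_def mats_def)

lemma site_op_slice:
  assumes L: "sop_on {..<d} L" and a: "a \<in> tens d n" and b: "b \<in> tens d n"
  shows "site_op d n L k X a b = L (slice d k X a b) (a k) (b k)"
  unfolding sop_on_expand[OF L finite_lessThan slice_mats] site_op_def using a b
  by (simp add: slice_def mult.commute)

text \<open>The \<open>(p, q)\<close> term of a slice's inner product is the term \<open>Q\<close>
  of the big one at \<open>a(k := p)\<close>, \<open>b(k := q)\<close>. Averaging over row and over
  column tuples each contributes a factor d.\<close>

lemma hs_ip_site_op:
  assumes L: "sop_on {..<d} L" and k: "k < n" and d: "0 < d"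
  shows "hs_ip (tens d n) X (site_op d n L k X)
    = (\<Sum>a\<in>tens d n. \<Sum>b\<in>tens d n. hs_ip {..<d} (slice d k X a b) (L (slice d k X a b))) / of_nat (d\<^sup>2)"
proof -
  define Q where "Q = (\<lambda>a b. cnj (X a b) * L (slice d k X a b) (a k) (b k))"
  have sl: "slice d k X (a(k := p)) (b(k := q)) = slice d k X a b" for a b p q
    by (simp add: slice_def cong: if_cong)
  have "(\<Sum>a\<in>tens d n. \<Sum>b\<in>tens d n. hs_ip {..<d} (slice d k X a b) (L (slice d k X a b)))
     = (\<Sum>a\<in>tens d n. \<Sum>b\<in>tens d n. \<Sum>p<d. \<Sum>q<d. Q (a(k := p)) (b(k := q)))"
    unfolding hs_ip_def Q_def sl by (intro sum.cong refl) (simp add: slice_def)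
  also have "\<dots> = (\<Sum>a\<in>tens d n. \<Sum>p<d. \<Sum>b\<in>tens d n. \<Sum>q<d. Q (a(k := p)) (b(k := q)))"
    by (rule sum.cong[OF refl]) (rule sum.swap)
  also have "\<dots> = of_nat d * (of_nat d * (\<Sum>a\<in>tens d n. \<Sum>b\<in>tens d n. Q a b))"
    unfolding sum_tens_average[OF k] sum_distrib_left[symmetric]
    by (subst sum_tens_average[OF k, where d = d and G = "\<lambda>a. \<Sum>b\<in>tens d n. Q a b"]) simp
  also have "(\<Sum>a\<in>tens d n. \<Sum>b\<in>tens d n. Q a b) = hs_ip (tens d n) X (site_op d n L k X)"
    unfolding hs_ip_def Q_def by (intro sum.cong refl) (simp add: site_op_slice[OF L])
  finally show ?thesis using d by (simp add: power2_eq_square)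
qed

lemma dirichlet_lift:
  assumes L: "sop_on {..<d} L" and d: "0 < d" and X: "hermitian (tens d n) X"
  shows "dirichlet (tens d n) (lift d n L) X =
    (\<Sum>k<n. \<Sum>a\<in>tens d n. \<Sum>b\<in>tens d n.
       - Re (hs_ip {..<d} (slice d k X a b) (L (slice d k X a b)))) / (real (d\<^sup>2) * real (d ^ n))"
proof -
  have "hs_ip (tens d n) X (lift d n L X)
      = (\<Sum>a\<in>tens d n. \<Sum>b\<in>tens d n. \<Sum>k<n. cnj (X a b) * site_op d n L k X a b)"
    by (simp add: hs_ip_def lift_def sum_distrib_left)
  also have "\<dots> = (\<Sum>a\<in>tens d n. \<Sum>k<n. \<Sum>b\<in>tens d n. cnj (X a b) * site_op d n L k X a b)"
    by (rule sum.cong[OF refl]) (rule sum.swap)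
  also have "\<dots> = (\<Sum>k<n. hs_ip (tens d n) X (site_op d n L k X))"
    unfolding hs_ip_def by (rule sum.swap)
  also have "\<dots> = (\<Sum>k<n. \<Sum>a\<in>tens d n. \<Sum>b\<in>tens d n.
      hs_ip {..<d} (slice d k X a b) (L (slice d k X a b))) / of_real (real (d\<^sup>2))"
    by (simp add: hs_ip_site_op[OF L _ d] sum_divide_distrib)
  finally show ?thesis
    unfolding dirichlet_eq[OF X] card_tens
    by (simp only: Re_divide_of_real Re_sum sum_negf) simp
qed

text \<open>The two lifted forms are the same nonnegative combination of one-site forms. With a
  weight on either side, one statement covers the upper bound (1, \<open>nrm\<close>), the lower
  bound (\<open>gap\<close>, 1) and nonnegativity (0, 1).\<close>

lemma dirichlet_lift_mono:
  assumes L: "sop_on {..<d} L" and L': "sop_on {..<d} L'" and d: "0 < d" and X: "hermitian (tens d n) X"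
    and le: "\<And>Y. Y \<in> mats {..<d} \<Longrightarrow>
      c * - Re (hs_ip {..<d} Y (L Y)) \<le> c' * - Re (hs_ip {..<d} Y (L' Y))"
  shows "c * dirichlet (tens d n) (lift d n L) X \<le> c' * dirichlet (tens d n) (lift d n L') X"
  unfolding dirichlet_lift[OF L d X] dirichlet_lift[OF L' d X] times_divide_eq_right sum_distrib_left
  by (intro divide_right_mono sum_mono le slice_mats) auto

theorem mainTheorem3:
  fixes d n :: nat and L :: "nat sop"
  assumes "2 \<le> d" and "1 \<le> n"
    and "liouvillian {..<d} L" and "doubly_stochastic {..<d} L" and "primitive {..<d} L"
  shows "op_norm {..<d} (sop_sym {..<d} L) * alpha2 (tens d n) (lift d n (ldep {..<d}))
            \<ge> alpha2 (tens d n) (lift d n L)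
       \<and> alpha2 (tens d n) (lift d n L)
            \<ge> spectral_gap {..<d} L * alpha2 (tens d n) (lift d n (ldep {..<d}))"
proof -
  let ?I = "{..<d}" and ?T = "tens d n"
  let ?dep = "ldep ?I"
  define P where "P = (\<lambda>X. posdef ?T X \<and> \<not> (\<exists>c. X = mscale c (mone ?T)))"
  define R where "R = (\<lambda>L X. dirichlet ?T (lift d n L) X / ent2 ?T X)"
  define nrm where "nrm = op_norm ?I (sop_sym ?I L)"
  define gap where "gap = spectral_gap ?I L"
  have alpha: "alpha2 ?T (lift d n L') = Inf {R L' X | X. P X}" for L'
    by (simp add: alpha2_def R_def P_def)
  have d: "0 < d" and fin: "finite ?I" and card: "2 \<le> card ?I"
    using assms(1) by auto
  have "0 \<in> ?I" using d by simp
  then have ne: "?I \<noteq> {}" by blast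
  note L = assms(3) and ds = assms(4)
  have s: "sop_on ?I L" using L by (simp add: liouvillian_def)
  have sd: "sop_on ?I ?dep" by (rule ldep_sop_on[OF fin])
  have "d ^ 1 \<le> d ^ n" using assms(1,2) by (intro power_increasing) auto
  then have cardT: "2 \<le> card ?T" using assms(1) by (simp add: card_tens)
  have exP: "\<exists>X. P X"
    unfolding P_def by (rule exists_nonscalar_posdef[OF finite_tens cardT])
  have ent: "0 \<le> ent2 ?T X" if "P X" for X
    using that cardT by (intro ent2_nonneg finite_tens) (auto simp: P_def)
  have herm: "hermitian ?T X" if "P X" for X using that by (simp add: P_def posdef_def)
  have R_mono: "c * R L1 X \<le> c' * R L2 X"
    if "c * dirichlet ?T (lift d n L1) X \<le> c' * dirichlet ?T (lift d n L2) X" "P X" for c c' L1 L2 X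
    unfolding R_def times_divide_eq_right using that ent by (intro divide_right_mono) auto
  have upper: "R L X \<le> nrm * R ?dep X" if "P X" for X
    using R_mono[OF dirichlet_lift_mono[OF s sd d herm[OF that], of 1 nrm] that]
      dissipation_le_op_norm[OF fin ne L ds] by (simp add: nrm_def)
  have lower: "gap * R ?dep X \<le> R L X" if "P X" for X
    using R_mono[OF dirichlet_lift_mono[OF sd s d herm[OF that], of gap 1] that]
      spectral_gap_le_dissipation[OF fin ne L ds] by (simp add: gap_def)
  \<comment> \<open>With weight 0 on the left; on one site, the depolarizing form is a squared norm
    by \<open>hs_norm_centre\<close>.\<close>
  have dep_nonneg: "0 \<le> R ?dep X" if "P X" for X
    using R_mono[OF dirichlet_lift_mono[OF sd sd d herm[OF that], of 0 1] that]
    by (simp flip: hs_norm_centre[OF fin ne])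
  have gap: "0 \<le> gap" unfolding gap_def by (rule spectral_gap_nonneg[OF fin card L ds])
  have nrm: "0 \<le> nrm" unfolding nrm_def by (rule op_norm_sop_sym_nonneg[OF s fin ne])
  have Inf_le: "Inf {R L' X | X. P X} \<le> R L' X"
    if nn: "\<And>X. P X \<Longrightarrow> 0 \<le> R L' X" and "P X" for L' X
    by (rule cInf_lower, use that(2) in blast, rule bdd_belowI[of _ 0]) (use nn in blast)
  have L_nonneg: "0 \<le> R L X" if "P X" for X
    using lower[OF that] mult_nonneg_nonneg[OF gap dep_nonneg[OF that]] by simp
  have "gap * Inf {R ?dep X | X. P X} \<le> Inf {R L X | X. P X}"
  proof (rule cInf_greatest)
    fix x assume "x \<in> {R L X | X. P X}"
    then obtain X where X: "x = R L X" "P X" by blast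
    have "gap * Inf {R ?dep X | X. P X} \<le> gap * R ?dep X"
      by (intro mult_left_mono gap Inf_le[OF dep_nonneg X(2)])
    then show "gap * Inf {R ?dep X | X. P X} \<le> x" using lower[OF X(2)] X(1) by simp
  qed (use exP in blast)
  moreover have "Inf {R L X | X. P X} \<le> nrm * Inf {R ?dep X | X. P X}"
  \<comment> \<open>For positive \<open>nrm\<close> the constant is moved across by division; for
    \<open>nrm = 0\<close> a single admissible \<open>X\<close> already has ratio at most 0.\<close>
  proof (cases "nrm = 0")
    case True
    obtain X where X: "P X" using exP by blast
    show ?thesis using Inf_le[OF L_nonneg X] upper[OF X] True by simp
  next
    case False
    then have pos: "nrm > 0" using nrm by simp
    have "Inf {R L X | X. P X} / nrm \<le> Inf {R ?dep X | X. P X}"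
    proof (rule cInf_greatest)
      fix x assume "x \<in> {R ?dep X | X. P X}"
      then obtain X where X: "x = R ?dep X" "P X" by blast
      show "Inf {R L X | X. P X} / nrm \<le> x"
        using Inf_le[OF L_nonneg X(2)] upper[OF X(2)] X(1) pos
        by (simp add: pos_divide_le_eq mult.commute)
    qed (use exP in blast)
    then show ?thesis using pos by (simp add: pos_divide_le_eq mult.commute)
  qed
  ultimately show ?thesis unfolding alpha nrm_def gap_def by simp
qed

end
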